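(* Let $G$ and $F$ be completable graphs on $\{1,\dots,n\}$, let $A(G)$ be a $G$-partial positive definite matrix and $B(F)$ an $F$-partial positive definite matrix, and let $t\in[0,1]$. Then there exists a unique $H\in A(G)\#_tB(F)$ such that $$\det(H)=\max\{\det(M\#_tN): M\#_tN\in A(G)\#_tB(F)\}.$$ Furthermore $H=\widehat{A}\#_t\widehat{B}$, where $\widehat{A},\widehat{B}$ are the maximum determinant positive definite completions of $A(G),B(F)$.
   Context: A graph $G=(V,E)$ is a finite undirected graph on $V=\{1,\dots,n\}$ containing all loops. A $G$-partial matrix has entries specified exactly for $\{i,j\}\in E$; a completion agrees with it on $E$. It is partial positive definite if Hermitian on $E$ and every principal submatrix indexed by a clique is positive definite. $G$ is completable if every $G$-partial positive semidefinite matrix has a positive semidefinite completion (equivalently chordal). $\mathfrak{p}^+[\cdot]$ is the set of positive definite completions; the maximum determinant positive definite completion is its unique element of largest determinant. For positive definite $M,N$, $M\#_tN:=M^{1/2}(M^{-1/2}NM^{-1/2})^tM^{1/2}$, and $A(G)\#_tB(F):=\{M\#_tN: M\in\mathfrak{p}^+[A(G)],\ N\in\mathfrak{p}^+[B(F)]\}$. *)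

theory Defs
  imports Complex_Main "Jordan_Normal_Form.Matrix" "Jordan_Normal_Form.DL_Submatrix" "Jordan_Normal_Form.Determinant"
begin

(* Matrices are complex n x n matrices of Jordan_Normal_Form, indexed by 0..<n
   (the paper's vertex set {1,...,n} is shifted to {0,...,n-1}). *)

definition cadj :: "complex mat \<Rightarrow> complex mat" where
  "cadj A = mat (dim_col A) (dim_row A) (\<lambda>(i,j). cnj (A $$ (j,i)))"

definition qform :: "complex mat \<Rightarrow> complex vec \<Rightarrow> complex" where
  "qform A v = (\<Sum>i<dim_row A. \<Sum>j<dim_col A. cnj (v $ i) * A $$ (i,j) * v $ j)"

definition hermitian :: "complex mat \<Rightarrow> bool" where
  "hermitian A \<longleftrightarrow> A \<in> carrier_mat (dim_row A) (dim_row A) \<and> cadj A = A"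

definition pos_def :: "complex mat \<Rightarrow> bool" where
  "pos_def A \<longleftrightarrow> hermitian A \<and>
     (\<forall>v \<in> carrier_vec (dim_row A). v \<noteq> 0\<^sub>v (dim_row A) \<longrightarrow> Re (qform A v) > 0)"

definition pos_semidef :: "complex mat \<Rightarrow> bool" where
  "pos_semidef A \<longleftrightarrow> hermitian A \<and>
     (\<forall>v \<in> carrier_vec (dim_row A). Re (qform A v) \<ge> 0)"

definition graph_on :: "nat \<Rightarrow> (nat \<times> nat) set \<Rightarrow> bool" where
  "graph_on n E \<longleftrightarrow> E \<subseteq> {0..<n} \<times> {0..<n} \<and> (\<forall>i<n. (i,i) \<in> E)
      \<and> (\<forall>i j. (i,j) \<in> E \<longrightarrow> (j,i) \<in> E)"

definition clique :: "(nat \<times> nat) set \<Rightarrow> nat set \<Rightarrow> bool" where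
  "clique E K \<longleftrightarrow> (\<forall>i\<in>K. \<forall>j\<in>K. (i,j) \<in> E)"

(* A G-partial matrix is represented by an n x n matrix A whose entries outside E are ignored. *)
definition herm_on :: "(nat \<times> nat) set \<Rightarrow> complex mat \<Rightarrow> bool" where
  "herm_on E A \<longleftrightarrow> (\<forall>(i,j)\<in>E. A $$ (j,i) = cnj (A $$ (i,j)))"

definition partial_pd :: "nat \<Rightarrow> (nat \<times> nat) set \<Rightarrow> complex mat \<Rightarrow> bool" where
  "partial_pd n E A \<longleftrightarrow> A \<in> carrier_mat n n \<and> herm_on E A \<and>
     (\<forall>K. K \<subseteq> {0..<n} \<and> K \<noteq> {} \<and> clique E K \<longrightarrow> pos_def (submatrix A K K))"

definition partial_psd :: "nat \<Rightarrow> (nat \<times> nat) set \<Rightarrow> complex mat \<Rightarrow> bool" where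
  "partial_psd n E A \<longleftrightarrow> A \<in> carrier_mat n n \<and> herm_on E A \<and>
     (\<forall>K. K \<subseteq> {0..<n} \<and> K \<noteq> {} \<and> clique E K \<longrightarrow> pos_semidef (submatrix A K K))"

definition completion_of :: "nat \<Rightarrow> (nat \<times> nat) set \<Rightarrow> complex mat \<Rightarrow> complex mat \<Rightarrow> bool" where
  "completion_of n E A M \<longleftrightarrow> M \<in> carrier_mat n n \<and> (\<forall>(i,j)\<in>E. M $$ (i,j) = A $$ (i,j))"

definition completable :: "nat \<Rightarrow> (nat \<times> nat) set \<Rightarrow> bool" where
  "completable n E \<longleftrightarrow> (\<forall>A. partial_psd n E A \<longrightarrow>
      (\<exists>M. completion_of n E A M \<and> pos_semidef M))"

definition pd_completions :: "nat \<Rightarrow> (nat \<times> nat) set \<Rightarrow> complex mat \<Rightarrow> complex mat set" where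
  "pd_completions n E A = {M. completion_of n E A M \<and> pos_def M}"

definition maxdet_completion :: "nat \<Rightarrow> (nat \<times> nat) set \<Rightarrow> complex mat \<Rightarrow> complex mat" where
  "maxdet_completion n E A = (THE M. M \<in> pd_completions n E A \<and>
      (\<forall>N \<in> pd_completions n E A. Re (det N) \<le> Re (det M)))"

definition unitary :: "complex mat \<Rightarrow> bool" where
  "unitary U \<longleftrightarrow> U \<in> carrier_mat (dim_row U) (dim_row U) \<and> U * cadj U = 1\<^sub>m (dim_row U)"

definition rdiag :: "nat \<Rightarrow> (nat \<Rightarrow> real) \<Rightarrow> complex mat" where
  "rdiag n d = mat n n (\<lambda>(i,j). if i = j then complex_of_real (d i) else 0)"

(* real power X^t of a positive definite matrix via the spectral decomposition
   X = U diag(d) U^*, X^t = U diag(d^t) U^* (independent of the decomposition) *)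
definition pd_powr :: "complex mat \<Rightarrow> real \<Rightarrow> complex mat" where
  "pd_powr X t = (SOME Y. \<exists>U d. unitary U \<and> dim_row U = dim_row X \<and>
      (\<forall>i<dim_row X. d i > 0) \<and>
      X = U * rdiag (dim_row X) d * cadj U \<and>
      Y = U * rdiag (dim_row X) (\<lambda>i. d i powr t) * cadj U)"

definition geo_mean :: "real \<Rightarrow> complex mat \<Rightarrow> complex mat \<Rightarrow> complex mat" where
  "geo_mean t M N = pd_powr M (1/2) *
      pd_powr (pd_powr M (-1/2) * N * pd_powr M (-1/2)) t * pd_powr M (1/2)"

definition geo_mean_set :: "real \<Rightarrow> nat \<Rightarrow> (nat \<times> nat) set \<Rightarrow> complex mat \<Rightarrow>
    (nat \<times> nat) set \<Rightarrow> complex mat \<Rightarrow> complex mat set" where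
  "geo_mean_set t n G A F B = {geo_mean t M N | M N. M \<in> pd_completions n G A \<and> N \<in> pd_completions n F B}"

end

theory Submission
  imports Defs "Jordan_Normal_Form.Spectral_Radius" "HOL-Analysis.Function_Topology"
begin

text \<open>
  Since \<open>det (M #\<^sub>t N) = det M\<^bsup>1-t\<^esup> det N\<^bsup>t\<^esup>\<close>, the determinant of the geometric mean is maximised by
  maximising both factors independently; for \<open>0 < t < 1\<close> a maximiser must maximise both, while for
  \<open>t = 0\<close> and \<open>t = 1\<close> the mean is \<open>M\<close> resp. \<open>N\<close>. A maximum determinant completion exists by
  compactness of the set of positive semidefinite completions, and is unique because the
  determinant strictly increases at the midpoint of two positive definite matrices of equal
  determinant.
\<close>

section \<open>Spectral theorem for Hermitian matrices\<close>

text \<open>A real power is given only through a choice: \<open>pd_powr\<close> selects a matrix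
  built from some spectral decomposition. So before the determinant of a mean can be computed, a
  decomposition must exist (\<open>hermitian_spectral\<close>) and the selected value must not
  depend on it (\<open>unitary_diag_fun_unique\<close>). After that, definiteness, determinants,
  powers and shifts by the identity are all read off the diagonal \<open>d\<close>. Uniqueness
  concerns the matrix \<open>H\<close>, not the pair behind it: for \<open>t = 0\<close> or
  \<open>t = 1\<close> one determinant disappears from the product, and all completions of that
  partial matrix give the same mean. Completability yields one positive definite completion;
  compactness then rests on the loops, which fix the diagonal, and uniqueness on the midpoint of two
  completions being a completion.\<close>

lemma mult_mat_entry:
  assumes "A \<in> carrier_mat n m" "B \<in> carrier_mat m l" "i < n" "j < l"
  shows "(A * B) $$ (i,j) = (\<Sum>k<m. A $$ (i,k) * B $$ (k,j))"
  using assms by (auto simp: scalar_prod_def lessThan_atLeast0 intro!: sum.cong)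

lemma mult_mat_vec_entry:
  assumes "A \<in> carrier_mat n m" "v \<in> carrier_vec m" "i < n"
  shows "(A *\<^sub>v v) $ i = (\<Sum>k<m. A $$ (i,k) * v $ k)"
  using assms by (auto simp: scalar_prod_def lessThan_atLeast0 intro!: sum.cong)

lemma cadj_carrier [simp, intro]: "A \<in> carrier_mat n m \<Longrightarrow> cadj A \<in> carrier_mat m n"
  by (auto simp: cadj_def)

lemma dim_cadj [simp]: "dim_row (cadj A) = dim_col A" "dim_col (cadj A) = dim_row A"
  by (auto simp: cadj_def)

lemma cadj_entry [simp]: "i < dim_col A \<Longrightarrow> j < dim_row A \<Longrightarrow> cadj A $$ (i,j) = cnj (A $$ (j,i))"
  by (auto simp: cadj_def)

lemma cadj_cadj [simp]: "cadj (cadj A) = A"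
  by (rule eq_matI) auto

lemma cadj_one [simp]: "cadj (1\<^sub>m n) = 1\<^sub>m n"
  by (rule eq_matI) auto

lemma cadj_mult:
  assumes "A \<in> carrier_mat n m" "B \<in> carrier_mat m l"
  shows "cadj (A * B) = cadj B * cadj A"
proof (rule eq_matI)
  fix i j assume "i < dim_row (cadj B * cadj A)" "j < dim_col (cadj B * cadj A)"
  then have i: "i < l" and j: "j < n" using assms by auto
  have "cadj (A * B) $$ (i,j) = cnj ((A * B) $$ (j,i))"
    using i j assms by (intro cadj_entry) auto
  also have "\<dots> = (\<Sum>k<m. cadj B $$ (i,k) * cadj A $$ (k,j))"
    using i j assms by (simp add: mult_mat_entry[OF assms j i] mult.commute)
  also have "\<dots> = (cadj B * cadj A) $$ (i,j)"
    using mult_mat_entry[OF cadj_carrier[OF assms(2)] cadj_carrier[OF assms(1)] i j] by simp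
  finally show "cadj (A * B) $$ (i,j) = (cadj B * cadj A) $$ (i,j)" .
qed (use assms in auto)

lemma cadj_mult3:
  assumes "A \<in> carrier_mat n n" "B \<in> carrier_mat n n" "C \<in> carrier_mat n n"
  shows "cadj (A * B * C) = cadj C * cadj B * cadj A"
  using assms by (simp add: cadj_mult[of _ n n _ n] assoc_mult_mat[of _ n n _ n _ n])

lemma unitary_cadj_mult:
  assumes "unitary U" "U \<in> carrier_mat n n"
  shows "U * cadj U = 1\<^sub>m n" "cadj U * U = 1\<^sub>m n"
proof -
  show *: "U * cadj U = 1\<^sub>m n" using assms by (auto simp: unitary_def)
  show "cadj U * U = 1\<^sub>m n"
    using mat_mult_left_right_inverse[OF assms(2) cadj_carrier[OF assms(2)] *] .
qed

lemma rdiag_carrier [simp, intro]: "rdiag n d \<in> carrier_mat n n"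
  by (auto simp: rdiag_def)

lemma dim_rdiag [simp]: "dim_row (rdiag n d) = n" "dim_col (rdiag n d) = n"
  by (auto simp: rdiag_def)

lemma nonzero_vec_entry:
  fixes v :: "complex vec"
  assumes "v \<in> carrier_vec n" "v \<noteq> 0\<^sub>v n"
  obtains k where "k < n" "v $ k \<noteq> 0"
  using assms by (metis carrier_vecD eq_vecI index_zero_vec)

text \<open>The reflection \<open>1 - c w w\<^sup>*\<close> along \<open>w = v + r u e\<^sub>0\<close>, where \<open>r\<close> is the norm of \<open>v\<close> and \<open>u\<close> is
  the phase of \<open>v\<^sub>0\<close>, so that no cancellation occurs in \<open>w\<^sub>0\<close>.\<close>

lemma householder_reflection:
  fixes v :: "complex vec"
  assumes v: "v \<in> carrier_vec n" "v \<noteq> 0\<^sub>v n"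
  obtains U a where "U \<in> carrier_mat n n" "cadj U = U" "U * U = 1\<^sub>m n"
    "U *\<^sub>v v = a \<cdot>\<^sub>v unit_vec n 0" "a \<noteq> 0"
proof -
  obtain k where k: "k < n" "v $ k \<noteq> 0" using nonzero_vec_entry[OF v] .
  then have n: "n > 0" by simp
  define s where "s = (\<Sum>k<n. (cmod (v $ k))\<^sup>2)"
  have s: "s > 0"
    unfolding s_def using k by (intro sum_pos2[of _ k]) auto
  define r where "r = sqrt s"
  have r: "r > 0" "r * r = s" using s by (auto simp: r_def)
  \<comment> \<open>The default 1 keeps \<open>cmod u = 1\<close> when \<open>v $ 0\<close> has no
    phase.\<close>
  define u where "u = (if v $ 0 = 0 then 1 else sgn (v $ 0))"
  have u: "v $ 0 = of_real (cmod (v $ 0)) * u" "cmod u = 1"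
    by (auto simp: u_def norm_sgn) (simp add: sgn_eq)
  have uu: "cnj u * u = 1" using u(2)
    by (metis complex_cnj_mult complex_mod_mult_cnj complex_cnj_complex_of_real mult.commute of_real_1 complex_cnj_one power_one complex_norm_square)
  define m where "m = cmod (v $ 0)"
  define w where "w = (\<lambda>i. if i = 0 then of_real (m + r) * u else v $ i)"
  \<comment> \<open>This is 2 divided by the squared norm of \<open>w\<close>, which is computed in
    \<open>ww\<close>.\<close>
  define c where "c = 1 / (s + r * m)"
  have den: "s + r * m > 0" using s r by (simp add: m_def add_pos_nonneg)
  have split: "(\<Sum>k<n. f k) = f 0 + (\<Sum>k=1..<n. f k)" for f :: "nat \<Rightarrow> complex"
    using n by (simp add: lessThan_atLeast0 sum.atLeast_Suc_lessThan)
  define T where "T = (\<Sum>k=1..<n. cnj (v $ k) * v $ k)"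
  have v0: "cnj (v $ 0) * v $ 0 = of_real (m * m)"
    by (simp add: m_def mult.commute complex_norm_square[symmetric] power2_eq_square[symmetric])
  have "of_real s = (\<Sum>k<n. cnj (v $ k) * v $ k)"
    unfolding s_def of_real_sum by (intro sum.cong) (simp_all add: complex_norm_square mult.commute flip: of_real_power)
  then have sT: "of_real s = of_real (m * m) + T" unfolding split T_def v0 by simp
  have T_w: "(\<Sum>k=1..<n. cnj (w k) * w k) = T" "(\<Sum>k=1..<n. cnj (w k) * v $ k) = T"
    unfolding T_def w_def by (auto intro!: sum.cong)
  have T_eq: "T = of_real (s - m * m)" using sT by (simp add: algebra_simps)
  have "cnj (w 0) * w 0 = of_real ((m + r) * (m + r)) * (cnj u * u)"
    by (simp add: w_def)
  then have w0: "cnj (w 0) * w 0 = of_real ((m + r) * (m + r))" by (simp add: uu)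
  have "cnj (w 0) * v $ 0 = of_real ((m + r) * m) * (cnj u * u)"
    by (subst u(1)) (simp add: w_def m_def)
  then have wv0: "cnj (w 0) * v $ 0 = of_real ((m + r) * m)" by (simp add: uu)
  \<comment> \<open>The squared norm of \<open>w\<close> is twice its inner product with
    \<open>v\<close>. This makes the reflection send \<open>v\<close> to \<open>v - w\<close>, a
    multiple of the first unit vector.\<close>
  have ww: "(\<Sum>k<n. cnj (w k) * w k) = of_real (2 * (s + r * m))"
    unfolding split w0 T_w T_eq of_real_add[symmetric]
    by (rule arg_cong[of _ _ of_real]) (use r(2) in \<open>simp add: algebra_simps\<close>)
  have wv: "(\<Sum>k<n. cnj (w k) * v $ k) = of_real (s + r * m)"
    unfolding split wv0 T_w T_eq of_real_add[symmetric]
    by (rule arg_cong[of _ _ of_real]) (simp add: algebra_simps)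
  define U where "U = mat n n (\<lambda>(i,j). (if i = j then 1 else 0) - of_real c * w i * cnj (w j))"
  have U: "U \<in> carrier_mat n n" by (simp add: U_def)
  have "cadj U = U"
    by (rule eq_matI) (auto simp: U_def)
  moreover have "U * U = 1\<^sub>m n"
  proof (rule eq_matI)
    fix i j assume "i < dim_row (1\<^sub>m n :: complex mat)" "j < dim_col (1\<^sub>m n :: complex mat)"
    then have i: "i < n" and j: "j < n" by auto
    have "(U * U) $$ (i,j) = (\<Sum>k<n. U $$ (i,k) * U $$ (k,j))"
      by (rule mult_mat_entry[OF U U i j])
    also have "\<dots> = (\<Sum>k<n. (if k = j then (if i = k then 1 else 0) else 0)
        - (if i = k then of_real c * w k * cnj (w j) else 0)
        - (if k = j then of_real c * w i * cnj (w k) else 0)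
        + of_real c * of_real c * w i * cnj (w j) * (cnj (w k) * w k))"
      using i j by (intro sum.cong) (auto simp: U_def algebra_simps)
    also have "\<dots> = (if i = j then 1 else 0) - 2 * (of_real c * w i * cnj (w j))
        + of_real c * of_real c * w i * cnj (w j) * of_real (2 * (s + r * m))"
      using i j by (simp add: sum.distrib sum_subtractf sum.delta ww sum_distrib_left[symmetric])
    also have "of_real c * of_real c * w i * cnj (w j) * of_real (2 * (s + r * m))
        = of_real (c * (s + r * m)) * (2 * (of_real c * w i * cnj (w j)))"
      by (simp only: of_real_mult of_real_numeral mult_ac)
    also have "c * (s + r * m) = 1" using den by (simp add: c_def)
    finally show "(U * U) $$ (i,j) = 1\<^sub>m n $$ (i,j)" using i j by simp
  qed (use U in auto)
  moreover have "U *\<^sub>v v = (- of_real r * u) \<cdot>\<^sub>v unit_vec n 0"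
  proof (rule eq_vecI)
    fix i assume "i < dim_vec ((- of_real r * u) \<cdot>\<^sub>v unit_vec n 0)"
    then have i: "i < n" by simp
    have "(U *\<^sub>v v) $ i = (\<Sum>k<n. U $$ (i,k) * v $ k)"
      by (rule mult_mat_vec_entry[OF U v(1) i])
    also have "\<dots> = (\<Sum>k<n. (if i = k then v $ k else 0) - of_real c * w i * (cnj (w k) * v $ k))"
      using i by (intro sum.cong) (auto simp: U_def algebra_simps)
    also have "\<dots> = v $ i - of_real c * w i * of_real (s + r * m)"
      using i by (simp add: sum_subtractf sum.delta wv sum_distrib_left[symmetric])
    also have "of_real c * w i * of_real (s + r * m) = of_real (c * (s + r * m)) * w i"
      by (simp only: of_real_mult mult_ac)
    also have "c * (s + r * m) = 1" using den by (simp add: c_def)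
    also have "v $ i - of_real 1 * w i = (if i = 0 then - of_real r * u else 0)"
      using u(1) by (auto simp: w_def m_def algebra_simps)
    finally show "(U *\<^sub>v v) $ i = ((- of_real r * u) \<cdot>\<^sub>v unit_vec n 0) $ i"
      using i by simp
  qed (use U in auto)
  moreover have "- of_real r * u \<noteq> 0" using r u(2) by auto
  ultimately show ?thesis using U that by blast
qed

section \<open>Diagonalisation by deflation\<close>

lemma hermitian_mult_cadj:
  assumes "hermitian A" "A \<in> carrier_mat n n" "C \<in> carrier_mat n n"
  shows "hermitian (C * A * cadj C)"
  using assms by (auto simp: hermitian_def cadj_mult3[of _ n])

lemma unitary_mult:
  assumes "unitary U" "U \<in> carrier_mat n n" "unitary V" "V \<in> carrier_mat n n"
  shows "unitary (U * V)"
proof -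
  note c = assms(2,4) cadj_carrier[OF assms(2)] cadj_carrier[OF assms(4)]
  have "U * V * cadj (U * V) = U * (V * cadj V) * cadj U"
    using c by (simp add: cadj_mult[of _ n n _ n] assoc_mult_mat[of _ n n _ n _ n] mult_carrier_mat[of _ n n])
  also have "\<dots> = 1\<^sub>m n"
    using assms c by (simp add: unitary_cadj_mult)
  finally show ?thesis using assms by (auto simp: unitary_def)
qed

text \<open>Deflation: a reflection \<open>H\<close> carries an eigenvector to a multiple of the
  first unit vector, so the first column of \<open>H * A * H\<close> vanishes below the corner. By
  symmetry so does the first row beyond the corner, and the remaining Hermitian block has size
  \<open>n\<close>. Complex scalars guarantee an eigenvalue to start with.\<close>

theorem hermitian_spectral:
  assumes "A \<in> carrier_mat n n" "hermitian A"
  shows "\<exists>U d. unitary U \<and> U \<in> carrier_mat n n \<and> A = U * rdiag n d * cadj U"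
  using assms
proof (induction n arbitrary: A)
  case 0
  then show ?case
    by (intro exI[of _ "1\<^sub>m 0"] exI[of _ "\<lambda>_. 0"]) (auto simp: unitary_def)
next
  case (Suc n)
  let ?N = "Suc n"
  note A = Suc.prems(1)
  obtain e where "e \<in> spectrum A" using spectrum_non_empty[OF A] by auto
  then obtain v where v: "v \<in> carrier_vec ?N" "v \<noteq> 0\<^sub>v ?N" "A *\<^sub>v v = e \<cdot>\<^sub>v v"
    using A by (auto simp: spectrum_def eigenvalue_def eigenvector_def)
  obtain H a where H: "H \<in> carrier_mat ?N ?N" "cadj H = H" "H * H = 1\<^sub>m ?N"
    "H *\<^sub>v v = a \<cdot>\<^sub>v unit_vec ?N 0" "a \<noteq> 0"
    using householder_reflection[OF v(1,2)] by blast
  define B where "B = H * A * H"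
  have B: "B \<in> carrier_mat ?N ?N" using H A by (auto simp: B_def)
  have hB: "cadj B = B"
    using hermitian_mult_cadj[OF Suc.prems(2) A H(1)] H(2) by (simp add: B_def hermitian_def)
  have HBH: "H * B * H = A"
  proof -
    have "H * B * H = (H * H) * A * (H * H)"
      unfolding B_def using H(1) A by (simp add: assoc_mult_mat[of _ ?N ?N _ ?N _ ?N])
    then show ?thesis using H A by simp
  qed
  \<comment> \<open>\<open>H\<close> is an involution, so it also carries the unit vector back to
    \<open>v\<close>; hence the unit vector is an eigenvector of \<open>B\<close>.\<close>
  have "H *\<^sub>v (a \<cdot>\<^sub>v unit_vec ?N 0) = (H * H) *\<^sub>v v"
    using assoc_mult_mat_vec[OF H(1) H(1) v(1)] H(4) by simp
  then have "H *\<^sub>v (a \<cdot>\<^sub>v unit_vec ?N 0) = v" using H v by simp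
  then have "B *\<^sub>v (a \<cdot>\<^sub>v unit_vec ?N 0) = H *\<^sub>v (A *\<^sub>v v)"
    using H v A by (simp add: B_def assoc_mult_mat_vec[of _ ?N ?N _ ?N])
  also have "\<dots> = e \<cdot>\<^sub>v (a \<cdot>\<^sub>v unit_vec ?N 0)"
    using H v by (simp add: mult_mat_vec[of _ ?N ?N])
  finally have Bv: "B *\<^sub>v (a \<cdot>\<^sub>v unit_vec ?N 0) = e \<cdot>\<^sub>v (a \<cdot>\<^sub>v unit_vec ?N 0)" .
  have B0: "B $$ (i,0) = (if i = 0 then e else 0)" if i: "i < ?N" for i
  proof -
    have "(B *\<^sub>v (a \<cdot>\<^sub>v unit_vec ?N 0)) $ i = (\<Sum>k<?N. if k = 0 then B $$ (i,k) * a else 0)"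
      unfolding mult_mat_vec_entry[OF B smult_carrier_vec[THEN iffD2, OF unit_vec_carrier] i]
      by (intro sum.cong) auto
    then have "B $$ (i,0) * a = (if i = 0 then e * a else 0)"
      unfolding Bv using i by (auto simp: sum.delta simp del: sum.lessThan_Suc split: if_splits)
    then show ?thesis using H(5) by (cases "i = 0") auto
  qed
  have Bh: "B $$ (i,j) = cnj (B $$ (j,i))" if "i < ?N" "j < ?N" for i j
    using cadj_entry[of i B j] hB B that by auto
  \<comment> \<open>\<open>rdiag\<close> takes real entries, so the eigenvalue has to be real; it is
    a diagonal entry of the Hermitian matrix \<open>B\<close>.\<close>
  have eR: "e = of_real (Re e)"
    using Bh[of 0 0] B0[of 0] by (simp add: complex_eq_iff)
  define C where "C = mat n n (\<lambda>(i,j). B $$ (Suc i, Suc j))"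
  have C: "C \<in> carrier_mat n n" by (simp add: C_def)
  have "hermitian C" unfolding hermitian_def
    by (auto simp: C_def intro!: eq_matI intro: Bh[symmetric])
  then obtain W d where W: "unitary W" "W \<in> carrier_mat n n" "C = W * rdiag n d * cadj W"
    using Suc.IH[OF C] by blast
  \<comment> \<open>Direct sum of a scalar and a block. It respects products and adjoints, so the
    decomposition of \<open>C\<close> lifts to one of \<open>B\<close>.\<close>
  define ext where "ext x X = four_block_mat (x \<cdot>\<^sub>m 1\<^sub>m 1) (0\<^sub>m 1 n) (0\<^sub>m n 1) X" for x :: complex and X
  have ext_mult: "ext x X * ext y Y = ext (x * y) (X * Y)"
    if "X \<in> carrier_mat n n" "Y \<in> carrier_mat n n" for x X y Y
    unfolding ext_def using that
    by (subst mult_four_block_mat[of _ 1 1 _ n _ n _ _ 1 _ n])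
       (auto intro!: cong_four_block_mat eq_matI simp: scalar_prod_def)
  have ext_carrier: "ext x X \<in> carrier_mat ?N ?N" if "X \<in> carrier_mat n n" for x X
    using that by (auto simp: ext_def)
  have ext_cadj: "cadj (ext x X) = ext (cnj x) (cadj X)" if "X \<in> carrier_mat n n" for x X
    using that by (intro eq_matI) (auto simp: ext_def)
  have B_ext: "B = ext e C"
  proof (rule eq_matI)
    fix i j assume "i < dim_row (ext e C)" "j < dim_col (ext e C)"
    then have ij: "i < ?N" "j < ?N" using C by (auto simp: ext_def)
    show "B $$ (i,j) = ext e C $$ (i,j)"
      using ij B0[of i] B0[of j] Bh[of i j] C
      by (cases i; cases j) (auto simp: ext_def C_def)
  qed (use B C in \<open>auto simp: ext_def\<close>)
  define d' where "d' k = (case k of 0 \<Rightarrow> Re e | Suc l \<Rightarrow> d l)" for k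
  have ext_diag: "ext e (rdiag n d) = rdiag ?N d'"
    using eR by (intro eq_matI) (auto simp: ext_def rdiag_def d'_def split: nat.splits)
  define V where "V = ext 1 W"
  have V: "V \<in> carrier_mat ?N ?N" using W by (simp add: V_def ext_carrier)
  have "V * cadj V = ext 1 (1\<^sub>m n)"
    using W by (simp add: V_def ext_cadj ext_mult unitary_cadj_mult)
  also have "\<dots> = 1\<^sub>m ?N" by (intro eq_matI) (auto simp: ext_def)
  finally have uV: "unitary V" using V by (auto simp: unitary_def)
  have BV: "B = V * rdiag ?N d' * cadj V"
    using W by (simp add: V_def ext_cadj ext_diag[symmetric] ext_mult B_ext mult_carrier_mat[of _ n n])
  have uH: "unitary H" using H by (auto simp: unitary_def)
  have "A = (H * V) * rdiag ?N d' * cadj (H * V)"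
    using H V by (subst HBH[symmetric], subst BV)
       (simp add: cadj_mult[of _ ?N ?N _ ?N] assoc_mult_mat[of _ ?N ?N _ ?N _ ?N] mult_carrier_mat[of _ ?N ?N])
  then show ?case
    using unitary_mult[OF uH H(1) uV V] H V by (intro exI[of _ "H * V"] exI[of _ d']) auto
qed

section \<open>Functional calculus\<close>

lemma conj_diag_entry:
  assumes "S \<in> carrier_mat n n" "i < n" "j < n"
  shows "(S * rdiag n d * cadj S) $$ (i,j) = (\<Sum>k<n. S $$ (i,k) * of_real (d k) * cnj (S $$ (j,k)))"
proof -
  have *: "(S * rdiag n d) $$ (i,k) = S $$ (i,k) * of_real (d k)" if "k < n" for k
  proof -
    have "(S * rdiag n d) $$ (i,k) = (\<Sum>l<n. if l = k then S $$ (i,l) * of_real (d l) else 0)"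
      unfolding mult_mat_entry[OF assms(1) rdiag_carrier assms(2) that]
      using that by (intro sum.cong) (auto simp: rdiag_def)
    then show ?thesis using that by (simp add: sum.delta)
  qed
  have "(S * rdiag n d * cadj S) $$ (i,j) = (\<Sum>k<n. (S * rdiag n d) $$ (i,k) * cadj S $$ (k,j))"
    using assms by (intro mult_mat_entry) auto
  also have "\<dots> = (\<Sum>k<n. S $$ (i,k) * of_real (d k) * cnj (S $$ (j,k)))"
    using assms by (intro sum.cong) (auto simp: * simp del: index_mult_mat)
  finally show ?thesis .
qed

lemma conj_diag_carrier [simp]: "S \<in> carrier_mat n n \<Longrightarrow> S * rdiag n d * cadj S \<in> carrier_mat n n"
  by (meson cadj_carrier mult_carrier_mat rdiag_carrier)

lemma rdiag_cong: "(\<And>i. i < n \<Longrightarrow> d i = e i) \<Longrightarrow> rdiag n d = rdiag n e"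
  by (intro eq_matI) (auto simp: rdiag_def)

lemma rdiag_one: "rdiag n (\<lambda>_. 1) = 1\<^sub>m n"
  by (intro eq_matI) (auto simp: rdiag_def)

lemma cadj_rdiag [simp]: "cadj (rdiag n d) = rdiag n d"
  by (intro eq_matI) (auto simp: rdiag_def)

lemma rdiag_mult: "rdiag n d * rdiag n e = rdiag n (\<lambda>i. d i * e i)"
proof (rule eq_matI)
  fix i j assume "i < dim_row (rdiag n (\<lambda>i. d i * e i))" "j < dim_col (rdiag n (\<lambda>i. d i * e i))"
  then have ij: "i < n" "j < n" by auto
  have "(rdiag n d * rdiag n e) $$ (i,j) =
      (\<Sum>k<n. if k = i then (if i = j then of_real (d i * e i) else 0) else 0)"
    unfolding mult_mat_entry[OF rdiag_carrier rdiag_carrier ij]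
    using ij by (intro sum.cong) (auto simp: rdiag_def)
  then show "(rdiag n d * rdiag n e) $$ (i,j) = rdiag n (\<lambda>i. d i * e i) $$ (i,j)"
    using ij by (simp add: sum.delta rdiag_def)
qed auto

lemma det_rdiag: "det (rdiag n d) = of_real (\<Prod>i<n. d i)"
proof -
  have "det (rdiag n d) = prod_list (diag_mat (rdiag n d))"
    by (rule det_upper_triangular[of _ n]) (auto simp: rdiag_def)
  also have "\<dots> = (\<Prod>i<n. rdiag n d $$ (i,i))"
    by (simp add: prod_list_diag_prod lessThan_atLeast0)
  also have "\<dots> = of_real (\<Prod>i<n. d i)"
    unfolding of_real_prod by (intro prod.cong) (auto simp: rdiag_def)
  finally show ?thesis .
qed

text \<open>The factor in front depends on \<open>S\<close> alone, so matrices diagonalised by one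
  congruence are compared through their diagonal products. \<open>S\<close> may be far from
  unitary.\<close>

lemma det_conj_diag:
  assumes "S \<in> carrier_mat n n"
  shows "det (S * rdiag n d * cadj S) = det S * det (cadj S) * of_real (\<Prod>i<n. d i)"
  using assms by (simp add: det_mult[of _ n] det_rdiag mult_carrier_mat[of _ n n])

lemma det_unitary_diag:
  assumes "unitary U" "U \<in> carrier_mat n n"
  shows "det (U * rdiag n d * cadj U) = of_real (\<Prod>i<n. d i)"
proof -
  have "det U * det (cadj U) = det (U * cadj U)"
    using assms by (simp add: det_mult[of _ n])
  then show ?thesis using assms by (simp add: det_conj_diag unitary_cadj_mult)
qed

lemma unitary_diag_mult:
  assumes "unitary U" "U \<in> carrier_mat n n"
  shows "(U * rdiag n d * cadj U) * (U * rdiag n e * cadj U) = U * rdiag n (\<lambda>i. d i * e i) * cadj U"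
proof -
  note c = assms(2) cadj_carrier[OF assms(2)] rdiag_carrier
  have "(U * rdiag n d * cadj U) * (U * rdiag n e * cadj U)
      = U * rdiag n d * (cadj U * U) * rdiag n e * cadj U"
    using c by (simp add: assoc_mult_mat[of _ n n _ n _ n] mult_carrier_mat[of _ n n])
  also have "\<dots> = U * (rdiag n d * rdiag n e) * cadj U"
    using c assms by (simp add: assoc_mult_mat[of _ n n _ n _ n] mult_carrier_mat[of _ n n] unitary_cadj_mult)
  finally show ?thesis by (simp add: rdiag_mult)
qed

section \<open>Quadratic forms and definiteness under congruence\<close>

text \<open>The change of variable behind both congruence lemmas below.\<close>

lemma qform_mult_cadj:
  assumes C: "C \<in> carrier_mat n n" and A: "A \<in> carrier_mat n n" and v: "v \<in> carrier_vec n"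
  shows "qform (C * A * cadj C) v = qform A (cadj C *\<^sub>v v)"
proof -
  have qf: "qform X v = (\<Sum>i<n. cnj (v $ i) * (X *\<^sub>v v) $ i)"
    if X: "X \<in> carrier_mat n n" and v: "v \<in> carrier_vec n" for X v
    using X v by (auto simp: qform_def mult_mat_vec_entry[OF X v] sum_distrib_left mult.assoc
        simp del: index_mult_mat_vec intro!: sum.cong)
  define w where "w = cadj C *\<^sub>v v"
  have w: "w \<in> carrier_vec n" using C v by (auto simp: w_def intro!: mult_mat_vec_carrier[of _ n n])
  define z where "z = A *\<^sub>v w"
  have z: "z \<in> carrier_vec n" using A w by (auto simp: z_def intro!: mult_mat_vec_carrier[of _ n n])
  have CACv: "(C * A * cadj C) *\<^sub>v v = C *\<^sub>v z"
    using A C v by (simp add: z_def w_def assoc_mult_mat_vec[of _ n n _ n] mult_carrier_mat[of _ n n] mult_mat_vec_carrier[of _ n n])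
  have "qform (C * A * cadj C) v = (\<Sum>i<n. cnj (v $ i) * (C *\<^sub>v z) $ i)"
    using A C v by (subst qf) (auto simp: CACv)
  also have "\<dots> = (\<Sum>i<n. \<Sum>k<n. cnj (v $ i) * (C $$ (i,k) * z $ k))"
    by (simp add: mult_mat_vec_entry[OF C z] sum_distrib_left)
  also have "\<dots> = (\<Sum>k<n. \<Sum>i<n. cnj (v $ i) * (C $$ (i,k) * z $ k))"
    by (rule sum.swap)
  also have "\<dots> = (\<Sum>k<n. cnj (w $ k) * z $ k)"
  proof (rule sum.cong)
    fix k assume "k \<in> {..<n}"
    then have k: "k < n" by simp
    have "cnj (w $ k) = (\<Sum>i<n. C $$ (i,k) * cnj (v $ i))"
      using C k by (simp add: w_def mult_mat_vec_entry[OF cadj_carrier[OF C] v k])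
    then show "(\<Sum>i<n. cnj (v $ i) * (C $$ (i,k) * z $ k)) = cnj (w $ k) * z $ k"
      by (simp add: sum_distrib_left mult_ac)
  qed simp
  also have "\<dots> = qform A w" using A w by (simp add: qf z_def)
  finally show ?thesis by (simp add: w_def)
qed

lemma qform_rdiag:
  assumes "v \<in> carrier_vec n"
  shows "qform (rdiag n d) v = of_real (\<Sum>i<n. d i * (cmod (v $ i))\<^sup>2)"
proof -
  have "qform (rdiag n d) v = (\<Sum>i<n. \<Sum>j<n. if i = j then of_real (d i * (cmod (v $ i))\<^sup>2) else 0)"
    unfolding qform_def dim_rdiag
    by (intro sum.cong) (auto simp: rdiag_def complex_norm_square simp flip: of_real_power)
  also have "\<dots> = (\<Sum>i<n. of_real (d i * (cmod (v $ i))\<^sup>2))"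
    by (intro sum.cong) (auto simp: sum.delta')
  finally show ?thesis by simp
qed

text \<open>Taking adjoints in \<open>C * D = 1\<close> gives \<open>cadj C\<close> a left inverse,
  so the change of variable sends no nonzero vector to zero and strict positivity survives.\<close>

lemma pos_def_congruence:
  assumes N: "pos_def N" "N \<in> carrier_mat n n"
    and C: "C \<in> carrier_mat n n" "D \<in> carrier_mat n n" "C * D = 1\<^sub>m n"
  shows "pos_def (C * N * cadj C)"
  unfolding pos_def_def
proof (intro conjI ballI impI)
  show "hermitian (C * N * cadj C)"
    using N C by (intro hermitian_mult_cadj) (auto simp: pos_def_def)
  fix v :: "complex vec" assume v: "v \<in> carrier_vec (dim_row (C * N * cadj C))" "v \<noteq> 0\<^sub>v (dim_row (C * N * cadj C))"
  then have v': "v \<in> carrier_vec n" "v \<noteq> 0\<^sub>v n" using C by auto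
  have w: "cadj C *\<^sub>v v \<in> carrier_vec n" using C v' by (auto intro!: mult_mat_vec_carrier[of _ n n])
  have "cadj C *\<^sub>v v \<noteq> 0\<^sub>v n"
  proof
    assume *: "cadj C *\<^sub>v v = 0\<^sub>v n"
    have "cadj D * cadj C = 1\<^sub>m n" using C cadj_mult[OF C(1,2)] by simp
    then have "v = (cadj D * cadj C) *\<^sub>v v" using v' by simp
    also have "\<dots> = cadj D *\<^sub>v (cadj C *\<^sub>v v)"
      using C v' by (intro assoc_mult_mat_vec) auto
    also have "\<dots> = 0\<^sub>v n"
      unfolding * using C by (intro eq_vecI) auto
    finally show False using v' by simp
  qed
  then show "Re (qform (C * N * cadj C) v) > 0"
    using N w by (simp add: qform_mult_cadj[OF C(1) N(2) v'(1)] pos_def_def)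
qed

lemma pos_semidef_congruence:
  assumes N: "pos_semidef N" "N \<in> carrier_mat n n" and C: "C \<in> carrier_mat n n"
  shows "pos_semidef (C * N * cadj C)"
  unfolding pos_semidef_def
proof (intro conjI ballI impI)
  show "hermitian (C * N * cadj C)"
    using N C by (intro hermitian_mult_cadj) (auto simp: pos_semidef_def)
  fix v :: "complex vec" assume v: "v \<in> carrier_vec (dim_row (C * N * cadj C))"
  then have v': "v \<in> carrier_vec n" using C by auto
  have w: "cadj C *\<^sub>v v \<in> carrier_vec n" using C v' by (auto intro!: mult_mat_vec_carrier[of _ n n])
  then show "Re (qform (C * N * cadj C) v) \<ge> 0"
    using N w by (simp add: qform_mult_cadj[OF C(1) N(2) v'(1)] pos_semidef_def)
qed

lemma pos_def_rdiag_iff: "pos_def (rdiag n d) \<longleftrightarrow> (\<forall>i<n. d i > 0)"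
proof
  assume pd: "pos_def (rdiag n d)"
  show "\<forall>i<n. d i > 0"
  proof (intro allI impI)
    fix i assume i: "i < n"
    have "(\<Sum>k<n. d k * (cmod (unit_vec n i $ k))\<^sup>2) = (\<Sum>k<n. if k = i then d k else 0)"
      using i by (intro sum.cong) auto
    then have "Re (qform (rdiag n d) (unit_vec n i)) = d i"
      using i by (simp add: qform_rdiag sum.delta)
    moreover have "(unit_vec n i :: complex vec) \<noteq> 0\<^sub>v n"
      using i by (metis index_unit_vec(2) index_zero_vec(1) zero_neq_one)
    ultimately show "d i > 0" using pd by (auto simp: pos_def_def)
  qed
next
  assume d: "\<forall>i<n. d i > 0"
  show "pos_def (rdiag n d)"
    unfolding pos_def_def
  proof (intro conjI ballI impI)
    fix v :: "complex vec" assume "v \<in> carrier_vec (dim_row (rdiag n d))" "v \<noteq> 0\<^sub>v (dim_row (rdiag n d))"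
    then have v: "v \<in> carrier_vec n" "v \<noteq> 0\<^sub>v n" by auto
    obtain k where k: "k < n" "v $ k \<noteq> 0" using nonzero_vec_entry[OF v] .
    have "(\<Sum>i<n. d i * (cmod (v $ i))\<^sup>2) > 0"
      using k d by (intro sum_pos2[of _ k]) (auto intro!: mult_pos_pos mult_nonneg_nonneg simp: less_imp_le)
    then show "Re (qform (rdiag n d) v) > 0" using v by (simp add: qform_rdiag)
  qed (auto simp: hermitian_def)
qed

lemma pos_semidef_rdiag_iff: "pos_semidef (rdiag n d) \<longleftrightarrow> (\<forall>i<n. d i \<ge> 0)"
proof
  assume pd: "pos_semidef (rdiag n d)"
  show "\<forall>i<n. d i \<ge> 0"
  proof (intro allI impI)
    fix i assume i: "i < n"
    have "(\<Sum>k<n. d k * (cmod (unit_vec n i $ k))\<^sup>2) = (\<Sum>k<n. if k = i then d k else 0)"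
      using i by (intro sum.cong) auto
    then have "Re (qform (rdiag n d) (unit_vec n i)) = d i"
      using i by (simp add: qform_rdiag sum.delta)
    then show "d i \<ge> 0" using pd by (metis dim_rdiag(1) pos_semidef_def unit_vec_carrier)
  qed
next
  assume d: "\<forall>i<n. d i \<ge> 0"
  then show "pos_semidef (rdiag n d)"
    by (auto simp: pos_semidef_def hermitian_def qform_rdiag intro!: sum_nonneg)
qed

lemma unitary_conj_cancel:
  assumes "unitary U" "U \<in> carrier_mat n n" "X \<in> carrier_mat n n"
  shows "cadj U * (U * X * cadj U) * U = X"
proof -
  have "cadj U * (U * X * cadj U) * U = (cadj U * U) * X * (cadj U * U)"
    using assms(2,3) by (simp add: assoc_mult_mat[of _ n n _ n _ n] mult_carrier_mat[of _ n n])
  then show ?thesis using assms by (simp add: unitary_cadj_mult)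
qed

lemma pos_def_unitary_diag_iff:
  assumes "unitary U" "U \<in> carrier_mat n n"
  shows "pos_def (U * rdiag n d * cadj U) \<longleftrightarrow> (\<forall>i<n. d i > 0)"
proof
  assume "pos_def (U * rdiag n d * cadj U)"
  from pos_def_congruence[OF this, of n "cadj U" U] show "\<forall>i<n. d i > 0"
    using assms by (simp add: unitary_cadj_mult unitary_conj_cancel pos_def_rdiag_iff)
next
  assume "\<forall>i<n. d i > 0"
  then show "pos_def (U * rdiag n d * cadj U)"
    using assms by (intro pos_def_congruence[of _ n U "cadj U"]) (auto simp: unitary_cadj_mult pos_def_rdiag_iff)
qed

lemma pos_semidef_unitary_diag_iff:
  assumes "unitary U" "U \<in> carrier_mat n n"
  shows "pos_semidef (U * rdiag n d * cadj U) \<longleftrightarrow> (\<forall>i<n. d i \<ge> 0)"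
proof
  assume "pos_semidef (U * rdiag n d * cadj U)"
  from pos_semidef_congruence[OF this, of n "cadj U"] show "\<forall>i<n. d i \<ge> 0"
    using assms by (simp add: unitary_conj_cancel pos_semidef_rdiag_iff)
next
  assume "\<forall>i<n. d i \<ge> 0"
  then show "pos_semidef (U * rdiag n d * cadj U)"
    using assms by (intro pos_semidef_congruence) (auto simp: pos_semidef_rdiag_iff)
qed

section \<open>Spectral decompositions and real powers\<close>

lemma pos_def_spectral:
  assumes "pos_def A" "A \<in> carrier_mat n n"
  obtains U d where "unitary U" "U \<in> carrier_mat n n" "\<And>i. i < n \<Longrightarrow> d i > 0"
    "A = U * rdiag n d * cadj U"
proof -
  obtain U d where *: "unitary U" "U \<in> carrier_mat n n" "A = U * rdiag n d * cadj U"
    using hermitian_spectral[OF assms(2)] assms(1) by (auto simp: pos_def_def)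
  then show ?thesis using assms that by (auto simp: pos_def_unitary_diag_iff)
qed

lemma pos_semidef_spectral:
  assumes "pos_semidef A" "A \<in> carrier_mat n n"
  obtains U d where "unitary U" "U \<in> carrier_mat n n" "\<And>i. i < n \<Longrightarrow> d i \<ge> 0"
    "A = U * rdiag n d * cadj U"
proof -
  obtain U d where *: "unitary U" "U \<in> carrier_mat n n" "A = U * rdiag n d * cadj U"
    using hermitian_spectral[OF assms(2)] assms(1) by (auto simp: pos_semidef_def)
  then show ?thesis using assms that by (auto simp: pos_semidef_unitary_diag_iff)
qed

text \<open>The matrix \<open>V\<^sup>* U\<close> intertwines the two diagonal matrices, so its \<open>(i,j)\<close> entry vanishes
  unless \<open>d j = e i\<close>; hence it also intertwines their images under \<open>f\<close>.\<close>

lemma unitary_diag_fun_unique: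
  assumes U: "unitary U" "U \<in> carrier_mat n n" and V: "unitary V" "V \<in> carrier_mat n n"
    and eq: "U * rdiag n d * cadj U = V * rdiag n e * cadj V"
  shows "U * rdiag n (\<lambda>i. f (d i)) * cadj U = V * rdiag n (\<lambda>i. f (e i)) * cadj V"
proof -
  define W where "W = cadj V * U"
  note c = U(2) V(2) cadj_carrier[OF U(2)] cadj_carrier[OF V(2)]
  have W: "W \<in> carrier_mat n n" using c by (simp add: W_def mult_carrier_mat[of _ n n])
  have left: "cadj V * (U * rdiag n g * cadj U) * U = W * rdiag n g" for g
  proof -
    have "cadj V * (U * rdiag n g * cadj U) * U = W * rdiag n g * (cadj U * U)"
      unfolding W_def using c by (simp add: assoc_mult_mat[of _ n n _ n _ n] mult_carrier_mat[of _ n n])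
    then show ?thesis using U W by (simp add: unitary_cadj_mult mult_carrier_mat[of _ n n])
  qed
  have right: "cadj V * (V * rdiag n g * cadj V) * U = rdiag n g * W" for g
  proof -
    have "cadj V * (V * rdiag n g * cadj V) * U = (cadj V * V) * rdiag n g * W"
      unfolding W_def using c by (simp add: assoc_mult_mat[of _ n n _ n _ n] mult_carrier_mat[of _ n n])
    then show ?thesis using V W by (simp add: unitary_cadj_mult mult_carrier_mat[of _ n n])
  qed
  have entry1: "(W * rdiag n g) $$ (i,j) = W $$ (i,j) * of_real (g j)" if "i < n" "j < n" for i j g
  proof -
    have "(W * rdiag n g) $$ (i,j) = (\<Sum>k<n. if k = j then W $$ (i,j) * of_real (g j) else 0)"
      unfolding mult_mat_entry[OF W rdiag_carrier that] using that by (intro sum.cong) (auto simp: rdiag_def)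
    then show ?thesis using that by (simp add: sum.delta)
  qed
  have entry2: "(rdiag n g * W) $$ (i,j) = of_real (g i) * W $$ (i,j)" if "i < n" "j < n" for i j g
  proof -
    have "(rdiag n g * W) $$ (i,j) = (\<Sum>k<n. if k = i then of_real (g i) * W $$ (i,j) else 0)"
      unfolding mult_mat_entry[OF rdiag_carrier W that] using that by (intro sum.cong) (auto simp: rdiag_def)
    then show ?thesis using that by (simp add: sum.delta)
  qed
  have Wde: "W * rdiag n d = rdiag n e * W" using left[of d] right[of e] eq by simp
  have de: "W $$ (i,j) * of_real (d j) = of_real (e i) * W $$ (i,j)" if "i < n" "j < n" for i j
    using arg_cong[OF Wde, of "\<lambda>X. X $$ (i,j)"] unfolding entry1[OF that] entry2[OF that] .
  have fde: "W * rdiag n (\<lambda>i. f (d i)) = rdiag n (\<lambda>i. f (e i)) * W"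
  proof (rule eq_matI)
    fix i j assume "i < dim_row (rdiag n (\<lambda>i. f (e i)) * W)" "j < dim_col (rdiag n (\<lambda>i. f (e i)) * W)"
    then have ij: "i < n" "j < n" using W by auto
    have "W $$ (i,j) = 0 \<or> d j = e i" using de[OF ij] by (metis mult.commute mult_cancel_left of_real_eq_iff)
    then show "(W * rdiag n (\<lambda>i. f (d i))) $$ (i,j) = (rdiag n (\<lambda>i. f (e i)) * W) $$ (i,j)"
      by (auto simp: entry1[OF ij] entry2[OF ij] simp del: index_mult_mat)
  qed (use W in auto)
  have "U * rdiag n (\<lambda>i. f (d i)) * cadj U = (V * cadj V) * U * rdiag n (\<lambda>i. f (d i)) * cadj U"
    using U V by (simp add: unitary_cadj_mult)
  also have "\<dots> = V * (W * rdiag n (\<lambda>i. f (d i))) * cadj U"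
    unfolding W_def using c by (simp add: assoc_mult_mat[of _ n n _ n _ n] mult_carrier_mat[of _ n n])
  also have "\<dots> = V * rdiag n (\<lambda>i. f (e i)) * cadj V * (U * cadj U)"
    unfolding fde unfolding W_def using c by (simp add: assoc_mult_mat[of _ n n _ n _ n] mult_carrier_mat[of _ n n])
  also have "\<dots> = V * rdiag n (\<lambda>i. f (e i)) * cadj V"
    using U V by (simp add: unitary_cadj_mult mult_carrier_mat[of _ n n])
  finally show ?thesis .
qed

text \<open>Removes the choice operator: every decomposition with positive diagonal computes the
  power, because all of them give the same result.\<close>

lemma pd_powr_unitary_diag:
  assumes U: "unitary U" "U \<in> carrier_mat n n" and d: "\<And>i. i < n \<Longrightarrow> d i > 0"
  shows "pd_powr (U * rdiag n d * cadj U) t = U * rdiag n (\<lambda>i. d i powr t) * cadj U"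
proof -
  have dim: "dim_row (U * rdiag n d * cadj U) = n" using U by auto
  show ?thesis
    unfolding pd_powr_def dim
  proof (rule some_equality)
    show "\<exists>U' d'. unitary U' \<and> dim_row U' = n \<and> (\<forall>i<n. d' i > 0) \<and>
        U * rdiag n d * cadj U = U' * rdiag n d' * cadj U' \<and>
        U * rdiag n (\<lambda>i. d i powr t) * cadj U = U' * rdiag n (\<lambda>i. d' i powr t) * cadj U'"
      using assms by auto
  next
    fix Y
    assume "\<exists>U' d'. unitary U' \<and> dim_row U' = n \<and> (\<forall>i<n. d' i > 0) \<and>
        U * rdiag n d * cadj U = U' * rdiag n d' * cadj U' \<and>
        Y = U' * rdiag n (\<lambda>i. d' i powr t) * cadj U'"
    then obtain U' d' where *: "unitary U'" "dim_row U' = n"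
        "U * rdiag n d * cadj U = U' * rdiag n d' * cadj U'"
        "Y = U' * rdiag n (\<lambda>i. d' i powr t) * cadj U'" by blast
    then have "U' \<in> carrier_mat n n" by (auto simp: unitary_def)
    from unitary_diag_fun_unique[OF U *(1) this *(3), of "\<lambda>x. x powr t"]
    show "Y = U * rdiag n (\<lambda>i. d i powr t) * cadj U" using *(4) by simp
  qed
qed

lemma pos_def_det:
  assumes "pos_def A" "A \<in> carrier_mat n n"
  shows "det A = of_real (Re (det A))" "Re (det A) > 0"
proof -
  obtain U d where *: "unitary U" "U \<in> carrier_mat n n" "\<And>i. i < n \<Longrightarrow> d i > 0"
    "A = U * rdiag n d * cadj U" using pos_def_spectral[OF assms] by blast
  then have "det A = of_real (\<Prod>i<n. d i)" by (simp add: det_unitary_diag)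
  moreover have "(\<Prod>i<n. d i) > 0" using * by (intro prod_pos) auto
  ultimately show "det A = of_real (Re (det A))" "Re (det A) > 0" by (simp_all only: Re_complex_of_real)
qed

text \<open>One decomposition of \<open>A\<close> serves all exponents at once, so each law reduces
  to the law for \<open>powr\<close> on the diagonal.\<close>

lemma pd_powr_props:
  assumes "pos_def A" "A \<in> carrier_mat n n"
  shows pd_powr_carrier: "pd_powr A t \<in> carrier_mat n n"
    and pd_powr_pos_def: "pos_def (pd_powr A t)"
    and pd_powr_add: "pd_powr A s * pd_powr A t = pd_powr A (s + t)"
    and pd_powr_0: "pd_powr A 0 = 1\<^sub>m n"
    and pd_powr_1: "pd_powr A 1 = A"
    and det_pd_powr: "det (pd_powr A t) = of_real (Re (det A) powr t)"
proof -
  obtain U d where *: "unitary U" "U \<in> carrier_mat n n" "\<And>i. i < n \<Longrightarrow> d i > 0"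
    "A = U * rdiag n d * cadj U" using pos_def_spectral[OF assms] by blast
  note pw = pd_powr_unitary_diag[OF *(1-3), folded *(4)]
  show "pd_powr A t \<in> carrier_mat n n" "pos_def (pd_powr A t)"
    using * by (auto simp: pw pos_def_unitary_diag_iff less_imp_neq[symmetric])
  show "pd_powr A s * pd_powr A t = pd_powr A (s + t)"
    using * by (simp add: pw unitary_diag_mult powr_add)
  \<comment> \<open>Strict positivity matters here, since \<open>0 powr 0 = 0\<close>.\<close>
  have "rdiag n (\<lambda>i. d i powr 0) = 1\<^sub>m n" "rdiag n (\<lambda>i. d i powr 1) = rdiag n d"
    unfolding rdiag_one[symmetric] using *(3) by (auto intro!: rdiag_cong simp: less_imp_neq[symmetric] less_imp_le)
  then show "pd_powr A 0 = 1\<^sub>m n" "pd_powr A 1 = A"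
    using * by (simp_all add: pw unitary_cadj_mult)
  have "(\<Prod>i<n. d i powr t) = (\<Prod>i<n. d i) powr t"
    by (rule prod_powr_distrib[symmetric])
  then show "det (pd_powr A t) = of_real (Re (det A) powr t)"
    using * by (simp only: pw det_unitary_diag Re_complex_of_real)
qed

lemma cadj_pos_def: "pos_def A \<Longrightarrow> cadj A = A"
  by (simp add: pos_def_def hermitian_def)

section \<open>Geometric means and strict log-concavity of the determinant\<close>

text \<open>The two roots are mutually inverse, so the inner matrix is a congruence of
  \<open>N\<close> and can be undone. Both the means and the simultaneous diagonalisation in
  \<open>det_midpoint_gt\<close> build on this.\<close>

lemma geo_mean_core:
  assumes M: "pos_def M" "M \<in> carrier_mat n n" and N: "pos_def N" "N \<in> carrier_mat n n"
  shows "pos_def (pd_powr M (-1/2) * N * pd_powr M (-1/2))"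
    and "pd_powr M (-1/2) * N * pd_powr M (-1/2) \<in> carrier_mat n n"
    and "pd_powr M (1/2) * pd_powr M (-1/2) = 1\<^sub>m n"
    and "pd_powr M (-1/2) * pd_powr M (1/2) = 1\<^sub>m n"
    and "pd_powr M (1/2) * pd_powr M (1/2) = M"
    and "pd_powr M (1/2) * (pd_powr M (-1/2) * N * pd_powr M (-1/2)) * pd_powr M (1/2) = N"
proof -
  define P Q where "P = pd_powr M (1/2)" and "Q = pd_powr M (-1/2)"
  have c: "P \<in> carrier_mat n n" "Q \<in> carrier_mat n n" "cadj P = P" "cadj Q = Q"
    using pd_powr_carrier[OF M] pd_powr_pos_def[OF M] by (auto simp: P_def Q_def cadj_pos_def)
  have inv: "P * Q = 1\<^sub>m n" "Q * P = 1\<^sub>m n" "P * P = M"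
    unfolding P_def Q_def by (simp_all add: pd_powr_add[OF M] pd_powr_0[OF M] pd_powr_1[OF M])
  have "pos_def (Q * N * cadj Q)"
    using c inv N by (intro pos_def_congruence[of _ n _ P])
  moreover have "P * (Q * N * Q) * P = (P * Q) * N * (Q * P)"
    using c N by (simp add: assoc_mult_mat[of _ n n _ n _ n] mult_carrier_mat[of _ n n])
  moreover have "Q * N * Q \<in> carrier_mat n n"
    using c N by (simp add: mult_carrier_mat[of _ n n])
  ultimately show "pos_def (Q * N * Q)" "Q * N * Q \<in> carrier_mat n n"
    "P * Q = 1\<^sub>m n" "Q * P = 1\<^sub>m n" "P * P = M" "P * (Q * N * Q) * P = N"
    using c inv N by simp_all
qed

lemma geo_mean_0:
  assumes "pos_def M" "M \<in> carrier_mat n n" and "pos_def N" "N \<in> carrier_mat n n"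
  shows "geo_mean 0 M N = M"
  unfolding geo_mean_def
  using pd_powr_0[OF geo_mean_core(1,2)[OF assms]] geo_mean_core(5)[OF assms]
    pd_powr_carrier[OF assms(1,2), of "1/2"]
  by simp

lemma geo_mean_1:
  assumes "pos_def M" "M \<in> carrier_mat n n" and "pos_def N" "N \<in> carrier_mat n n"
  shows "geo_mean 1 M N = N"
  unfolding geo_mean_def
  using pd_powr_1[OF geo_mean_core(1,2)[OF assms]] geo_mean_core(6)[OF assms]
  by simp

text \<open>By multiplicativity the inner matrix has determinant \<open>det N / det M\<close>, its
  power contributes the \<open>t\<close>-th power of this quotient, and the two outer roots
  contribute \<open>det M\<close>.\<close>

lemma Re_det_geo_mean:
  assumes M: "pos_def M" "M \<in> carrier_mat n n" and N: "pos_def N" "N \<in> carrier_mat n n"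
  shows "Re (det (geo_mean t M N)) = Re (det M) powr (1 - t) * Re (det N) powr t"
proof -
  define P Q where "P = pd_powr M (1/2)" and "Q = pd_powr M (-1/2)"
  define m k where "m = Re (det M)" and "k = Re (det N)"
  have mk: "m > 0" "k > 0" "det N = of_real k"
    using pos_def_det[OF M] pos_def_det[OF N] by (simp_all add: m_def k_def)
  note core = geo_mean_core[OF M N, folded P_def Q_def]
  have c: "P \<in> carrier_mat n n" "Q \<in> carrier_mat n n"
    using pd_powr_carrier[OF M] by (auto simp: P_def Q_def)
  have dP: "det P = of_real (m powr (1/2))" and dQ: "det Q = of_real (m powr (-1/2))"
    using det_pd_powr[OF M] by (simp_all add: P_def Q_def m_def)
  define X where "X = Q * N * Q"
  have X: "pos_def X" "X \<in> carrier_mat n n" using core by (simp_all add: X_def)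
  have "det X = of_real (m powr (-1/2) * k * m powr (-1/2))"
    using c N mk by (simp add: X_def det_mult[of _ n] dQ mult_carrier_mat[of _ n n])
  also have "m powr (-1/2) * k * m powr (-1/2) = m powr (-1) * k"
    using powr_add[of m "-1/2" "-1/2"] by (simp add: mult_ac)
  finally have dX: "Re (det X) = m powr (-1) * k" by simp
  have "det (geo_mean t M N) = det (P * pd_powr X t * P)"
    by (simp add: geo_mean_def P_def Q_def X_def)
  also have "\<dots> = det P * det (pd_powr X t) * det P"
    using c pd_powr_carrier[OF X, of t] by (simp add: det_mult[of _ n] mult_carrier_mat[of _ n n])
  also have "\<dots> = of_real (m powr (1/2) * (m powr (-1) * k) powr t * m powr (1/2))"
    by (simp add: dP det_pd_powr[OF X] dX)
  also have "m powr (1/2) * (m powr (-1) * k) powr t * m powr (1/2)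
      = (m powr (1/2) * m powr (1/2)) * m powr (- t) * k powr t"
    using mk powr_powr[of m "-1" t] by (subst powr_mult) (simp_all del: powr_neg_one)
  also have "\<dots> = m powr (1 - t) * k powr t"
    using mk powr_add[of m 1 "- t"] by (simp flip: powr_add)
  finally show ?thesis by (simp add: m_def k_def)
qed

section \<open>Determinant of a midpoint\<close>

text \<open>Stated for arbitrary \<open>S\<close> because it serves both the unitary shift by the
  identity and the congruence in \<open>det_midpoint_gt\<close>, which is not unitary in
  general.\<close>

lemma conj_diag_lincomb:
  assumes "S \<in> carrier_mat n n"
  shows "of_real x \<cdot>\<^sub>m (S * rdiag n d * cadj S) + of_real y \<cdot>\<^sub>m (S * rdiag n e * cadj S)
    = S * rdiag n (\<lambda>i. x * d i + y * e i) * cadj S"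
proof (rule eq_matI)
  fix i j assume "i < dim_row (S * rdiag n (\<lambda>i. x * d i + y * e i) * cadj S)"
    "j < dim_col (S * rdiag n (\<lambda>i. x * d i + y * e i) * cadj S)"
  then have ij: "i < n" "j < n" using assms by auto
  have "(of_real x \<cdot>\<^sub>m (S * rdiag n d * cadj S) + of_real y \<cdot>\<^sub>m (S * rdiag n e * cadj S)) $$ (i,j)
      = of_real x * (S * rdiag n d * cadj S) $$ (i,j) + of_real y * (S * rdiag n e * cadj S) $$ (i,j)"
    using ij assms by simp
  also have "\<dots> = (S * rdiag n (\<lambda>i. x * d i + y * e i) * cadj S) $$ (i,j)"
    unfolding conj_diag_entry[OF assms ij]
    unfolding sum_distrib_left sum.distrib[symmetric]
    by (intro sum.cong) (simp_all add: algebra_simps)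
  finally show "(of_real x \<cdot>\<^sub>m (S * rdiag n d * cadj S) + of_real y \<cdot>\<^sub>m (S * rdiag n e * cadj S)) $$ (i,j)
    = (S * rdiag n (\<lambda>i. x * d i + y * e i) * cadj S) $$ (i,j)" .
qed (use assms in auto)

lemma one_smult_mat: "(1 :: complex) \<cdot>\<^sub>m A = A"
  by (intro eq_matI) auto

lemma unitary_diag_shift:
  assumes "unitary U" "U \<in> carrier_mat n n"
  shows "U * rdiag n d * cadj U + of_real c \<cdot>\<^sub>m 1\<^sub>m n = U * rdiag n (\<lambda>i. d i + c) * cadj U"
  using conj_diag_lincomb[OF assms(2), of 1 d c "\<lambda>_. 1"] assms
  by (simp add: rdiag_one unitary_cadj_mult one_smult_mat)

text \<open>Arithmetic against geometric mean, squared to avoid roots: \<open>q i\<close> compares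
  the squared mean of 1 and \<open>e i\<close> with their product and exceeds 1 by
  \<open>(1 - e i)\<^sup>2 / (4 * e i)\<close>. As the \<open>e i\<close> multiply to 1, the product
  of the \<open>q i\<close> is the square of the product in question.\<close>

lemma prod_mean_one_gt_1:
  fixes e :: "nat \<Rightarrow> real"
  assumes pos: "\<And>i. i < n \<Longrightarrow> e i > 0" and prod: "(\<Prod>i<n. e i) = 1" and j: "j < n" "e j \<noteq> 1"
  shows "(\<Prod>i<n. (1 + e i) / 2) > 1"
proof -
  define q where "q i = ((1 + e i) / 2)\<^sup>2 / e i" for i
  have q_eq: "q i = 1 + (1 - e i)\<^sup>2 / (4 * e i)" if "i < n" for i
    using pos[OF that] by (simp add: q_def field_simps power2_eq_square)
  have q1: "q i \<ge> 1" if "i < n" for i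
    using pos[OF that] by (simp add: q_eq[OF that])
  have qj: "q j > 1" using pos[OF j(1)] j(2) by (simp add: q_eq[OF j(1)])
  have "1 < q j * 1" using qj by simp
  also have "\<dots> \<le> q j * (\<Prod>i\<in>{..<n} - {j}. q i)"
    using qj q1 by (intro mult_left_mono prod_ge_1) auto
  also have "\<dots> = (\<Prod>i<n. q i)"
    using j(1) by (simp add: prod.remove[of "{..<n}" j])
  also have "\<dots> = (\<Prod>i<n. (1 + e i) / 2)\<^sup>2"
    unfolding q_def prod_dividef[of "\<lambda>i. ((1 + e i) / 2)\<^sup>2"] prod prod_power_distrib[symmetric] by simp
  finally have "1\<^sup>2 < (\<Prod>i<n. (1 + e i) / 2)\<^sup>2" by simp
  then show ?thesis
    by (rule power_less_imp_less_base) (use pos in \<open>auto intro!: prod_nonneg simp: add_nonneg_nonneg less_imp_le\<close>)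
qed

text \<open>Diagonalising both matrices by one congruence, \<open>M = S S\<^sup>*\<close> and \<open>N = S diag(e) S\<^sup>*\<close>, reduces
  strict log-concavity of the determinant to the inequality of arithmetic and geometric means
  for each pair \<open>(1, e i)\<close>.\<close>

lemma det_midpoint_gt:
  assumes M: "pos_def M" "M \<in> carrier_mat n n" and N: "pos_def N" "N \<in> carrier_mat n n"
    and eq: "Re (det M) = Re (det N)" and neq: "M \<noteq> N"
  shows "pos_def (of_real (1/2) \<cdot>\<^sub>m M + of_real (1/2) \<cdot>\<^sub>m N)"
    and "Re (det (of_real (1/2) \<cdot>\<^sub>m M + of_real (1/2) \<cdot>\<^sub>m N)) > Re (det M)"
proof -
  define P Q where "P = pd_powr M (1/2)" and "Q = pd_powr M (-1/2)"
  define X where "X = Q * N * Q"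
  note core = geo_mean_core[OF M N, folded P_def Q_def X_def]
  have c: "P \<in> carrier_mat n n" "Q \<in> carrier_mat n n" "cadj P = P"
    using pd_powr_carrier[OF M] pd_powr_pos_def[OF M] by (auto simp: P_def Q_def cadj_pos_def)
  obtain V e where V: "unitary V" "V \<in> carrier_mat n n" "\<And>i. i < n \<Longrightarrow> e i > 0"
    "X = V * rdiag n e * cadj V" using pos_def_spectral[OF core(1,2)] by blast
  \<comment> \<open>As \<open>V\<close> diagonalises \<open>X\<close>, this congruence gives
    \<open>M\<close> the constant diagonal 1 and \<open>N\<close> the diagonal
    \<open>e\<close>.\<close>
  define S where "S = P * V"
  have S: "S \<in> carrier_mat n n" using c V by (simp add: S_def mult_carrier_mat[of _ n n])
  have S_conj: "S * rdiag n d * cadj S = P * (V * rdiag n d * cadj V) * P" for d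
    unfolding S_def cadj_mult[OF c(1) V(2)] c(3)
    using c V(2) by (simp add: assoc_mult_mat[of _ n n _ n _ n] mult_carrier_mat[of _ n n])
  have Mid: "M = S * rdiag n (\<lambda>_. 1) * cadj S"
    using core(5) c V by (simp add: S_conj) (simp add: rdiag_one unitary_cadj_mult)
  have Nid: "N = S * rdiag n e * cadj S"
    using core V by (simp add: S_conj)
  define \<delta> where "\<delta> = Re (det M)"
  have \<delta>: "\<delta> > 0" "det S * det (cadj S) = of_real \<delta>"
    using pos_def_det[OF M] det_conj_diag[OF S, of "\<lambda>_. 1", folded Mid] by (simp_all add: \<delta>_def)
  have "Re (det N) = \<delta> * (\<Prod>i<n. e i)"
    using det_conj_diag[OF S, of e, folded Nid] unfolding \<delta>(2)
    by (simp only: of_real_mult[symmetric] Re_complex_of_real)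
  \<comment> \<open>Equality of the determinants is exactly the normalisation required by
    \<open>prod_mean_one_gt_1\<close>.\<close>
  then have prod1: "(\<Prod>i<n. e i) = 1" using eq \<delta> by (simp add: \<delta>_def)
  have "\<exists>j<n. e j \<noteq> 1"
  proof (rule ccontr)
    assume "\<not> (\<exists>j<n. e j \<noteq> 1)"
    then have "rdiag n e = rdiag n (\<lambda>_. 1)" by (intro rdiag_cong) auto
    then show False using neq Mid Nid by simp
  qed
  then obtain j where j: "j < n" "e j \<noteq> 1" by blast
  have comb: "of_real (1/2) \<cdot>\<^sub>m M + of_real (1/2) \<cdot>\<^sub>m N = S * rdiag n (\<lambda>i. (1 + e i) / 2) * cadj S"
  proof -
    have "of_real (1/2) \<cdot>\<^sub>m M + of_real (1/2) \<cdot>\<^sub>m N = S * rdiag n (\<lambda>i. 1/2 * 1 + 1/2 * e i) * cadj S"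
      by (subst Mid, subst Nid, rule conj_diag_lincomb[OF S])
    also have "rdiag n (\<lambda>i. 1/2 * 1 + 1/2 * e i) = rdiag n (\<lambda>i. (1 + e i) / 2)"
      by (intro rdiag_cong) (simp add: field_simps)
    finally show ?thesis .
  qed
  \<comment> \<open>The explicit inverse of \<open>S\<close>, wanted by
    \<open>pos_def_congruence\<close>.\<close>
  have "S * (cadj V * Q) = P * (V * cadj V) * Q"
    unfolding S_def using c V(2) by (simp add: assoc_mult_mat[of _ n n _ n _ n] mult_carrier_mat[of _ n n])
  then have Sinv: "S * (cadj V * Q) = 1\<^sub>m n" using c V core by (simp add: unitary_cadj_mult)
  show "pos_def (of_real (1/2) \<cdot>\<^sub>m M + of_real (1/2) \<cdot>\<^sub>m N)"
    unfolding comb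
  proof (rule pos_def_congruence[OF _ rdiag_carrier S _ Sinv])
    show "pos_def (rdiag n (\<lambda>i. (1 + e i) / 2))"
      using V(3) by (auto simp: pos_def_rdiag_iff intro: add_pos_pos)
    show "cadj V * Q \<in> carrier_mat n n" using c V by (simp add: mult_carrier_mat[of _ n n])
  qed
  have "Re (det (of_real (1/2) \<cdot>\<^sub>m M + of_real (1/2) \<cdot>\<^sub>m N)) = \<delta> * (\<Prod>i<n. (1 + e i) / 2)"
    unfolding comb det_conj_diag[OF S] \<delta>(2) by (simp only: of_real_mult[symmetric] Re_complex_of_real)
  also have "\<dots> > \<delta> * 1"
    by (intro mult_strict_left_mono prod_mean_one_gt_1[OF V(3) prod1 j] \<delta>)
  finally show "Re (det (of_real (1/2) \<cdot>\<^sub>m M + of_real (1/2) \<cdot>\<^sub>m N)) > Re (det M)"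
    by (simp add: \<delta>_def)
qed

section \<open>Maximum determinant completions\<close>

text \<open>The smallest eigenvalue measures how much of the identity can be subtracted. Allowing
  every smaller \<delta> lets finitely many principal submatrices share one shift.\<close>

lemma pos_def_shift_pos_semidef:
  assumes "pos_def A" "A \<in> carrier_mat n n"
  shows "\<exists>\<epsilon>>0. \<forall>\<delta>\<le>\<epsilon>. pos_semidef (A + of_real (- \<delta>) \<cdot>\<^sub>m 1\<^sub>m n)"
proof -
  obtain U d where *: "unitary U" "U \<in> carrier_mat n n" "\<And>i. i < n \<Longrightarrow> d i > 0"
    "A = U * rdiag n d * cadj U" using pos_def_spectral[OF assms] by blast
  \<comment> \<open>\<open>insert 1\<close> covers \<open>n = 0\<close>, where there are no
    eigenvalues.\<close>
  define \<epsilon> where "\<epsilon> = Min (insert 1 (d ` {..<n}))"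
  have "\<epsilon> > 0" using *(3) by (auto simp: \<epsilon>_def)
  moreover have "pos_semidef (A + of_real (- \<delta>) \<cdot>\<^sub>m 1\<^sub>m n)" if "\<delta> \<le> \<epsilon>" for \<delta>
  proof -
    have "\<delta> \<le> d i" if "i < n" for i
      using \<open>\<delta> \<le> \<epsilon>\<close> that by (auto simp: \<epsilon>_def)
    then show ?thesis
      unfolding *(4) unitary_diag_shift[OF *(1,2)] pos_semidef_unitary_diag_iff[OF *(1,2)] by simp
  qed
  ultimately show ?thesis by blast
qed

lemma pos_semidef_shift_pos_def:
  assumes "pos_semidef A" "A \<in> carrier_mat n n" "\<epsilon> > 0"
  shows "pos_def (A + of_real \<epsilon> \<cdot>\<^sub>m 1\<^sub>m n)"
proof -
  obtain U d where *: "unitary U" "U \<in> carrier_mat n n" "\<And>i. i < n \<Longrightarrow> d i \<ge> 0"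
    "A = U * rdiag n d * cadj U" using pos_semidef_spectral[OF assms(1,2)] by blast
  then show ?thesis
    using assms(3) by (simp add: unitary_diag_shift pos_def_unitary_diag_iff add_nonneg_pos)
qed

text \<open>The determinant is the product of nonnegative eigenvalues, so a positive value excludes
  the eigenvalue 0.\<close>

lemma pos_semidef_det_pos_imp_pos_def:
  assumes "pos_semidef A" "A \<in> carrier_mat n n" "Re (det A) > 0"
  shows "pos_def A"
proof -
  obtain U d where *: "unitary U" "U \<in> carrier_mat n n" "\<And>i. i < n \<Longrightarrow> d i \<ge> 0"
    "A = U * rdiag n d * cadj U" using pos_semidef_spectral[OF assms(1,2)] by blast
  then have "(\<Prod>i<n. d i) > 0" using assms(3) by (simp only: det_unitary_diag Re_complex_of_real)
  then have "\<forall>i<n. d i \<noteq> 0" by (auto simp: prod_zero_iff less_le)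
  then have "\<forall>i<n. d i > 0" using *(3) by (metis order_le_neq_trans)
  then show ?thesis unfolding *(4) pos_def_unitary_diag_iff[OF *(1,2)] .
qed

lemma pos_def_imp_pos_semidef: "pos_def A \<Longrightarrow> A \<in> carrier_mat n n \<Longrightarrow> pos_semidef A"
proof -
  assume A: "pos_def A" "A \<in> carrier_mat n n"
  obtain U d where *: "unitary U" "U \<in> carrier_mat n n" "\<And>i. i < n \<Longrightarrow> d i > 0"
    "A = U * rdiag n d * cadj U" using pos_def_spectral[OF A] by blast
  show ?thesis
    unfolding *(4) pos_semidef_unitary_diag_iff[OF *(1,2)] using *(3) by (simp add: less_imp_le)
qed

text \<open>A crude Cauchy-Schwarz: each entry is a sum with weights \<open>d k\<close> over
  products of entries of \<open>U\<close>, and \<open>x * y \<le> x\<^sup>2 + y\<^sup>2\<close>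
  splits it into two diagonal entries. It confines all completions once the diagonal is
  known.\<close>

lemma pos_semidef_entry_bound:
  assumes A: "pos_semidef A" "A \<in> carrier_mat n n" and ij: "i < n" "j < n"
  shows "cmod (A $$ (i,j)) \<le> cmod (A $$ (i,i)) + cmod (A $$ (j,j))"
proof -
  obtain U d where *: "unitary U" "U \<in> carrier_mat n n" "\<And>i. i < n \<Longrightarrow> d i \<ge> 0"
    "A = U * rdiag n d * cadj U" using pos_semidef_spectral[OF A] by blast
  have diag: "(\<Sum>k<n. d k * (cmod (U $$ (i,k)))\<^sup>2) = cmod (A $$ (i,i))" if "i < n" for i
  proof -
    have "A $$ (i,i) = of_real (\<Sum>k<n. d k * (cmod (U $$ (i,k)))\<^sup>2)"
      unfolding *(4) conj_diag_entry[OF *(2) that that] of_real_sum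
      by (intro sum.cong) (simp_all add: complex_norm_square mult_ac flip: of_real_power)
    moreover have "(\<Sum>k<n. d k * (cmod (U $$ (i,k)))\<^sup>2) \<ge> 0"
      using *(3) by (intro sum_nonneg) auto
    ultimately show ?thesis by (metis norm_of_real abs_of_nonneg)
  qed
  have "cmod (A $$ (i,j)) \<le> (\<Sum>k<n. cmod (U $$ (i,k) * of_real (d k) * cnj (U $$ (j,k))))"
    unfolding *(4) conj_diag_entry[OF *(2) ij] by (rule norm_sum)
  also have "\<dots> \<le> (\<Sum>k<n. d k * (cmod (U $$ (i,k)))\<^sup>2 + d k * (cmod (U $$ (j,k)))\<^sup>2)"
  proof (rule sum_mono)
    fix k assume "k \<in> {..<n}"
    then have dk: "d k \<ge> 0" using *(3) by simp
    define x y where "x = cmod (U $$ (i,k))" and "y = cmod (U $$ (j,k))"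
    have "x * y \<le> x\<^sup>2 + y\<^sup>2"
    proof -
      have "x \<ge> 0" "y \<ge> 0" by (simp_all add: x_def y_def)
      then have "x * y \<ge> 0" by simp
      then show ?thesis using sum_squares_bound[of x y] by linarith
    qed
    then have "d k * (x * y) \<le> d k * (x\<^sup>2 + y\<^sup>2)" using dk by (rule mult_left_mono)
    then show "cmod (U $$ (i,k) * of_real (d k) * cnj (U $$ (j,k)))
        \<le> d k * (cmod (U $$ (i,k)))\<^sup>2 + d k * (cmod (U $$ (j,k)))\<^sup>2"
      using dk by (simp add: norm_mult x_def y_def algebra_simps)
  qed
  also have "\<dots> = cmod (A $$ (i,i)) + cmod (A $$ (j,j))"
    by (simp add: sum.distrib diag ij)
  finally show ?thesis .
qed

text \<open>Completability only speaks about positive semidefinite data, so a small multiple of the identity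
  is subtracted before completing and added back afterwards; all loops belong to the graph, hence
  this changes specified entries only.\<close>

lemma pd_completions_nonempty:
  assumes G: "graph_on n E" "completable n E" and A: "partial_pd n E A"
  shows "pd_completions n E A \<noteq> {}"
proof -
  have cA: "A \<in> carrier_mat n n" and hA: "herm_on E A" using A by (auto simp: partial_pd_def)
  have E: "i < n" "j < n" if "(i,j) \<in> E" for i j using G(1) that by (auto simp: graph_on_def)
  define KK where "KK = {K. K \<subseteq> {0..<n} \<and> K \<noteq> {} \<and> clique E K}"
  have fin: "finite KK" by (rule finite_subset[of _ "Pow {0..<n}"]) (auto simp: KK_def)
  \<comment> \<open>\<open>dim_submatrix\<close> counts the indices below \<open>n\<close> that lie
    in \<open>K\<close>; here these are all of \<open>K\<close>.\<close>
  have card: "{i. i < n \<and> i \<in> K} = K" if "K \<in> KK" for K using that by (auto simp: KK_def)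
  have sub: "submatrix A K K \<in> carrier_mat (card K) (card K)" if "K \<in> KK" for K
    using cA card[OF that] by (intro carrier_matI) (simp_all add: dim_submatrix)
  have "\<exists>\<epsilon>>0. \<forall>\<delta>\<le>\<epsilon>. pos_semidef (submatrix A K K + of_real (- \<delta>) \<cdot>\<^sub>m 1\<^sub>m (card K))" if "K \<in> KK" for K
    using that A by (intro pos_def_shift_pos_semidef sub) (auto simp: partial_pd_def KK_def)
  then obtain \<epsilon> where \<epsilon>: "\<And>K. K \<in> KK \<Longrightarrow> \<epsilon> K > 0"
    "\<And>K \<delta>. K \<in> KK \<Longrightarrow> \<delta> \<le> \<epsilon> K \<Longrightarrow> pos_semidef (submatrix A K K + of_real (- \<delta>) \<cdot>\<^sub>m 1\<^sub>m (card K))"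
    by metis
  \<comment> \<open>One shift for all cliques, positive because there are finitely many; the
    inserted 1 covers the case of no nonempty clique.\<close>
  define \<delta> where "\<delta> = Min (insert 1 (\<epsilon> ` KK))"
  have \<delta>: "\<delta> > 0" "\<And>K. K \<in> KK \<Longrightarrow> \<delta> \<le> \<epsilon> K" using fin \<epsilon>(1) by (auto simp: \<delta>_def)
  define A' where "A' = A + of_real (- \<delta>) \<cdot>\<^sub>m 1\<^sub>m n"
  have cA': "A' \<in> carrier_mat n n" using cA by (simp add: A'_def)
  have "herm_on E A'"
    unfolding herm_on_def
  proof (safe)
    fix i j assume ij: "(i,j) \<in> E"
    then have "A $$ (j,i) = cnj (A $$ (i,j))" using hA by (auto simp: herm_on_def)
    then show "A' $$ (j,i) = cnj (A' $$ (i,j))" using E[OF ij] cA by (auto simp: A'_def)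
  qed
  moreover have "pos_semidef (submatrix A' K K)" if K: "K \<in> KK" for K
  proof -
    have "submatrix A' K K = submatrix A K K + of_real (- \<delta>) \<cdot>\<^sub>m 1\<^sub>m (card K)"
    proof (rule eq_matI)
      fix i j assume "i < dim_row (submatrix A K K + of_real (- \<delta>) \<cdot>\<^sub>m 1\<^sub>m (card K))"
        "j < dim_col (submatrix A K K + of_real (- \<delta>) \<cdot>\<^sub>m 1\<^sub>m (card K))"
      then have ij: "i < card K" "j < card K" by auto
      have "pick K i \<in> K" "pick K j \<in> K" using ij by (auto intro: pick_in_set_le)
      then have p: "pick K i < n" "pick K j < n" using K by (auto simp: KK_def)
      \<comment> \<open>\<open>pick K\<close> is injective on these indices, so the principal
        submatrix of the identity is again an identity.\<close>
      have "pick K i = pick K j \<longleftrightarrow> i = j" using ij by (metis linorder_neq_iff pick_mono_le)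
      then show "submatrix A' K K $$ (i,j) = (submatrix A K K + of_real (- \<delta>) \<cdot>\<^sub>m 1\<^sub>m (card K)) $$ (i,j)"
        using ij p cA cA' card[OF K] sub[OF K]
        by (simp add: submatrix_index carrier_matD) (auto simp: A'_def)
    qed (use cA' card[OF K] in \<open>auto simp: dim_submatrix\<close>)
    then show ?thesis using \<epsilon>(2)[OF K \<delta>(2)[OF K]] by simp
  qed
  ultimately have "partial_psd n E A'" using cA' by (auto simp: partial_psd_def KK_def)
  then obtain M where M: "completion_of n E A' M" "pos_semidef M"
    using G(2) by (auto simp: completable_def)
  have cM: "M \<in> carrier_mat n n" using M(1) by (simp add: completion_of_def)
  have "(M + of_real \<delta> \<cdot>\<^sub>m 1\<^sub>m n) $$ (i,j) = A $$ (i,j)" if ij: "(i,j) \<in> E" for i j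
  proof -
    have "M $$ (i,j) = A' $$ (i,j)" using M(1) ij by (auto simp: completion_of_def)
    then show ?thesis using E[OF ij] cM cA by (simp add: A'_def)
  qed
  then have "M + of_real \<delta> \<cdot>\<^sub>m 1\<^sub>m n \<in> pd_completions n E A"
    using pos_semidef_shift_pos_def[OF M(2) cM \<delta>(1)] cM
    by (auto simp: pd_completions_def completion_of_def)
  then show ?thesis by blast
qed

section \<open>Compactness and existence of a maximiser\<close>

text \<open>Tychonoff's theorem. Matrices will be encoded as functions on all index pairs, which
  carry the product topology.\<close>

lemma compact_PiE_UNIV:
  fixes S :: "'a \<Rightarrow> 'b::topological_space set"
  assumes "\<And>i. compact (S i)"
  shows "compact (PiE UNIV S)"
proof -
  have "compactin (product_topology (\<lambda>i. euclidean) UNIV) (PiE UNIV S)"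
    using assms by (auto simp: compactin_PiE)
  then show ?thesis by (simp add: euclidean_product_topology)
qed

text \<open>The disc is a closed subset of the continuous image of a compact square.\<close>

lemma compact_complex_disc: "compact {z :: complex. cmod z \<le> r}"
proof -
  let ?Q = "(\<lambda>p. Complex (fst p) (snd p)) ` ({-r..r} \<times> {-r..r})"
  have "compact ?Q"
    unfolding Complex_eq
    by (intro compact_continuous_image continuous_intros compact_Times compact_Icc)
  moreover have "{z. cmod z \<le> r} \<subseteq> ?Q"
  proof
    fix z :: complex assume "z \<in> {z. cmod z \<le> r}"
    then have "\<bar>Re z\<bar> \<le> r" "\<bar>Im z\<bar> \<le> r"
      using abs_Re_le_cmod[of z] abs_Im_le_cmod[of z] by auto
    then show "z \<in> ?Q" by (intro image_eqI[of _ _ "(Re z, Im z)"]) auto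
  qed
  moreover have "closed {z :: complex. cmod z \<le> r}"
    by (intro closed_Collect_le continuous_intros)
  ultimately show ?thesis
    using compact_Int_closed[of ?Q "{z. cmod z \<le> r}"] by (simp add: Int_absorb1)
qed

text \<open>The Leibniz formula is a polynomial in finitely many coordinates, and coordinates are
  continuous in the product topology.\<close>

lemma continuous_on_det_mat:
  "continuous_on UNIV (\<lambda>f :: nat \<times> nat \<Rightarrow> complex. det (mat n n f))"
proof -
  have "det (mat n n f) = (\<Sum>p | p permutes {0..<n}. signof p * (\<Prod>i=0..<n. f (i, p i)))"
    for f :: "nat \<times> nat \<Rightarrow> complex"
    unfolding det_def'[OF mat_carrier]
    by (intro sum.cong arg_cong2[of _ _ _ _ "(*)"] prod.cong) (auto dest: permutes_in_image)
  then show ?thesis by (simp add: continuous_intros)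
qed

text \<open>The diagonal is specified, so the positive semidefinite completions form a compact set.
  A maximiser of the determinant over them has positive determinant, hence is positive definite.\<close>

lemma maxdet_exists:
  assumes G: "graph_on n E" and ne: "pd_completions n E A \<noteq> {}"
  shows "\<exists>M \<in> pd_completions n E A. \<forall>N \<in> pd_completions n E A. Re (det N) \<le> Re (det M)"
proof -
  have E: "i < n" "j < n" if "(i,j) \<in> E" for i j using G that by (auto simp: graph_on_def)
  \<comment> \<open>The bound of \<open>pos_semidef_entry_bound\<close> on the prescribed diagonal,
    hence common to all completions.\<close>
  define R where "R i j = cmod (A $$ (i,i)) + cmod (A $$ (j,j))" for i j
  \<comment> \<open>Outside the block the value is pinned to 0, so that every factor of the infinite
    product is compact.\<close>
  define C where "C = (\<lambda>(i,j). if i < n \<and> j < n then {z :: complex. cmod z \<le> R i j} else {0})"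
  define herm where "herm = {f :: nat \<times> nat \<Rightarrow> complex. \<forall>i j. i < n \<longrightarrow> j < n \<longrightarrow> cnj (f (j,i)) = f (i,j)}"
  define agree where "agree = {f. \<forall>i j. (i,j) \<in> E \<longrightarrow> f (i,j) = A $$ (i,j)}"
  define nonneg where "nonneg = {f. \<forall>v. v \<in> carrier_vec n \<longrightarrow>
    0 \<le> Re (\<Sum>i<n. \<Sum>j<n. cnj (v $ i) * f (i,j) * v $ j)}"
  define T where "T = PiE UNIV C \<inter> (herm \<inter> agree \<inter> nonneg)"
  \<comment> \<open>Each set is an intersection of closed conditions, each on finitely many
    coordinates.\<close>
  have "closed herm" "closed agree" "closed nonneg"
    unfolding herm_def agree_def nonneg_def
    by (intro closed_Collect_all closed_Collect_imp closed_Collect_eq closed_Collect_le open_Collect_const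
        continuous_intros continuous_on_product_coordinates)+
  moreover have "compact (PiE UNIV C)"
    by (rule compact_PiE_UNIV) (auto simp: C_def compact_complex_disc split: prod.splits)
  ultimately have T_compact: "compact T" unfolding T_def by (intro compact_Int_closed closed_Int)
  have psd_iff: "pos_semidef (mat n n f) \<longleftrightarrow> f \<in> herm \<inter> nonneg" for f
  proof -
    have "hermitian (mat n n f) \<longleftrightarrow> f \<in> herm"
    proof
      assume "hermitian (mat n n f)"
      then have "cadj (mat n n f) = mat n n f" by (simp add: hermitian_def)
      then have *: "cadj (mat n n f) $$ (i,j) = mat n n f $$ (i,j)" for i j by simp
      have "cnj (f (j,i)) = f (i,j)" if "i < n" "j < n" for i j
        using *[of i j] that by simp
      then show "f \<in> herm" by (simp add: herm_def)
    next
      assume "f \<in> herm"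
      then show "hermitian (mat n n f)"
        by (auto simp: hermitian_def herm_def intro!: eq_matI)
    qed
    moreover have "qform (mat n n f) v = (\<Sum>i<n. \<Sum>j<n. cnj (v $ i) * f (i,j) * v $ j)" for v
      by (simp add: qform_def)
    ultimately show ?thesis by (auto simp: pos_semidef_def nonneg_def)
  qed
  have T_D: "pos_semidef (mat n n f) \<and> completion_of n E A (mat n n f)" if "f \<in> T" for f
    using that E psd_iff[of f] by (auto simp: T_def agree_def completion_of_def)
  have T_I: "\<exists>f\<in>T. mat n n f = M" if "M \<in> pd_completions n E A" for M
  proof
    define f where "f = (\<lambda>(i,j). if i < n \<and> j < n then M $$ (i,j) else 0)"
    have M: "M \<in> carrier_mat n n" "pos_def M" "\<And>i j. (i,j) \<in> E \<Longrightarrow> M $$ (i,j) = A $$ (i,j)"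
      using that by (auto simp: pd_completions_def completion_of_def)
    show f: "mat n n f = M" using M(1) by (intro eq_matI) (auto simp: f_def)
    have psd: "pos_semidef M" using pos_def_imp_pos_semidef[OF M(2,1)] .
    have "M $$ (i,i) = A $$ (i,i)" if "i < n" for i using M(3) G that by (auto simp: graph_on_def)
    then have "cmod (M $$ (i,j)) \<le> R i j" if "i < n" "j < n" for i j
      using pos_semidef_entry_bound[OF psd M(1) that] that by (simp add: R_def)
    then have "f \<in> PiE UNIV C" by (auto simp: f_def C_def)
    moreover have "f \<in> agree" using M(3) E by (auto simp: agree_def f_def)
    ultimately show "f \<in> T" using psd_iff[of f] psd f by (auto simp: T_def)
  qed
  obtain M0 where M0: "M0 \<in> pd_completions n E A" using ne by blast
  then have "T \<noteq> {}" using T_I by blast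
  moreover have "continuous_on T (\<lambda>f. Re (det (mat n n f)))"
    by (intro continuous_on_Re continuous_on_subset[OF continuous_on_det_mat]) auto
  ultimately obtain f where f: "f \<in> T" "\<And>g. g \<in> T \<Longrightarrow> Re (det (mat n n g)) \<le> Re (det (mat n n f))"
    using continuous_attains_sup[OF T_compact] by blast
  have max: "Re (det N) \<le> Re (det (mat n n f))" if "N \<in> pd_completions n E A" for N
    using T_I[OF that] f(2) by blast
  \<comment> \<open>A single positive definite completion bounds the maximum from below and so
    excludes a singular maximiser.\<close>
  have "Re (det M0) > 0"
    using M0 by (intro pos_def_det[of _ n]) (auto simp: pd_completions_def completion_of_def)
  then have "Re (det (mat n n f)) > 0" using max[OF M0] by simp
  then have "mat n n f \<in> pd_completions n E A"
    using T_D[OF f(1)] pos_semidef_det_pos_imp_pos_def[of "mat n n f" n] by (auto simp: pd_completions_def)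
  then show ?thesis using max by blast
qed

lemma maxdet_unique:
  assumes G: "graph_on n E"
    and M: "M \<in> pd_completions n E A" "\<And>K. K \<in> pd_completions n E A \<Longrightarrow> Re (det K) \<le> Re (det M)"
    and N: "N \<in> pd_completions n E A" "Re (det N) = Re (det M)"
  shows "M = N"
proof (rule ccontr)
  assume neq: "M \<noteq> N"
  have E: "i < n" "j < n" if "(i,j) \<in> E" for i j using G that by (auto simp: graph_on_def)
  have M': "pos_def M" "M \<in> carrier_mat n n" "\<And>i j. (i,j) \<in> E \<Longrightarrow> M $$ (i,j) = A $$ (i,j)"
    and N': "pos_def N" "N \<in> carrier_mat n n" "\<And>i j. (i,j) \<in> E \<Longrightarrow> N $$ (i,j) = A $$ (i,j)"
    using M(1) N(1) by (auto simp: pd_completions_def completion_of_def)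
  let ?K = "of_real (1/2) \<cdot>\<^sub>m M + of_real (1/2) \<cdot>\<^sub>m N"
  note mid = det_midpoint_gt[OF M'(1,2) N'(1,2) N(2)[symmetric] neq]
  \<comment> \<open>Prescribing entries is an affine condition, so the midpoint still agrees with
    \<open>A\<close> on \<open>E\<close>.\<close>
  have "?K $$ (i,j) = A $$ (i,j)" if "(i,j) \<in> E" for i j
    using E[OF that] M' N' that by simp
  then have "?K \<in> pd_completions n E A"
    using mid(1) M' N' by (auto simp: pd_completions_def completion_of_def)
  then show False using M(2)[of ?K] mid(2) by simp
qed

text \<open>Replaces the definite description by usable facts. The last one asks only for equal
  determinants, which is what the comparison of means delivers.\<close>

lemma maxdet_completion_props:
  assumes "graph_on n E" "completable n E" "partial_pd n E A"
  shows "maxdet_completion n E A \<in> pd_completions n E A"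
    and "N \<in> pd_completions n E A \<Longrightarrow> Re (det N) \<le> Re (det (maxdet_completion n E A))"
    and "N \<in> pd_completions n E A \<Longrightarrow> Re (det N) = Re (det (maxdet_completion n E A)) \<Longrightarrow>
      N = maxdet_completion n E A"
proof -
  obtain M where M: "M \<in> pd_completions n E A" "\<And>N. N \<in> pd_completions n E A \<Longrightarrow> Re (det N) \<le> Re (det M)"
    using maxdet_exists[OF assms(1) pd_completions_nonempty[OF assms]] by blast
  have "maxdet_completion n E A = M"
    unfolding maxdet_completion_def
  proof (rule the_equality)
    fix N assume "N \<in> pd_completions n E A \<and> (\<forall>K\<in>pd_completions n E A. Re (det K) \<le> Re (det N))"
    then show "N = M" using M maxdet_unique[OF assms(1) M, of N] by (simp add: order_antisym)
  qed (use M in blast)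
  then show "maxdet_completion n E A \<in> pd_completions n E A"
    "N \<in> pd_completions n E A \<Longrightarrow> Re (det N) \<le> Re (det (maxdet_completion n E A))"
    "N \<in> pd_completions n E A \<Longrightarrow> Re (det N) = Re (det (maxdet_completion n E A)) \<Longrightarrow>
      N = maxdet_completion n E A"
    using M maxdet_unique[OF assms(1) M, of N] by auto
qed

section \<open>Maximising over the set of means\<close>

text \<open>Both exponents are positive, so \<open>powr\<close> is strictly increasing in each base:
  a deficit in one factor cannot be made up by the other, which is bounded as well.\<close>

lemma weighted_product_max:
  fixes x y a b t :: real
  assumes "0 < x" "x \<le> a" "0 < y" "y \<le> b" "0 < t" "t < 1"
    and le: "a powr (1 - t) * b powr t \<le> x powr (1 - t) * y powr t"
  shows "x = a" "y = b"
proof -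
  have pos: "x powr (1 - t) > 0" "y powr t > 0" "a powr (1 - t) > 0" "b powr t > 0" using assms by auto
  have x: "x powr (1 - t) \<le> a powr (1 - t)" and y: "y powr t \<le> b powr t"
    using assms by (auto intro!: powr_mono2)
  show "x = a"
  proof (rule ccontr)
    assume "x \<noteq> a"
    then have "x powr (1 - t) < a powr (1 - t)" using assms by (intro powr_less_mono2) auto
    then have "x powr (1 - t) * y powr t < a powr (1 - t) * b powr t"
      using y pos by (intro mult_less_le_imp_less) auto
    then show False using le by simp
  qed
  show "y = b"
  proof (rule ccontr)
    assume "y \<noteq> b"
    then have "y powr t < b powr t" using assms by (intro powr_less_mono2) auto
    then have "x powr (1 - t) * y powr t < a powr (1 - t) * b powr t"
      using x pos by (intro mult_le_less_imp_less) auto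
    then show False using le by simp
  qed
qed

theorem theorem6p10:
  fixes n :: nat and G F :: "(nat \<times> nat) set" and A B :: "complex mat" and t :: real
  assumes "graph_on n G" and "graph_on n F"
    and "completable n G" and "completable n F"
    and "partial_pd n G A" and "partial_pd n F B"
    and "0 \<le> t" and "t \<le> 1"
  shows "(\<exists>!H. H \<in> geo_mean_set t n G A F B \<and>
            (\<forall>K \<in> geo_mean_set t n G A F B. Re (det K) \<le> Re (det H)))
         \<and> (let H = geo_mean t (maxdet_completion n G A) (maxdet_completion n F B) in
              H \<in> geo_mean_set t n G A F B \<and>
              (\<forall>K \<in> geo_mean_set t n G A F B. Re (det K) \<le> Re (det H)))"
proof -
  define P Q where "P = maxdet_completion n G A" and "Q = maxdet_completion n F B"
  note P = maxdet_completion_props[OF assms(1,3,5), folded P_def]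
    and Q = maxdet_completion_props[OF assms(2,4,6), folded Q_def]
  have pd: "pos_def M" "M \<in> carrier_mat n n" if "M \<in> pd_completions n E C" for M E C
    using that by (auto simp: pd_completions_def completion_of_def)
  have det_pos: "Re (det M) > 0" if "M \<in> pd_completions n E C" for M E C
    using pos_def_det(2)[OF pd[OF that]] .
  define H where "H = geo_mean t P Q"
  have H: "H \<in> geo_mean_set t n G A F B"
    unfolding geo_mean_set_def H_def using P(1) Q(1) by blast
  have det: "Re (det (geo_mean t M N)) = Re (det M) powr (1 - t) * Re (det N) powr t"
    if "M \<in> pd_completions n G A" "N \<in> pd_completions n F B" for M N
    by (rule Re_det_geo_mean[OF pd[OF that(1)] pd[OF that(2)]])
  have max: "Re (det K) \<le> Re (det H)" if K: "K \<in> geo_mean_set t n G A F B" for K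
  proof -
    obtain M N where MN: "K = geo_mean t M N" "M \<in> pd_completions n G A" "N \<in> pd_completions n F B"
      using K unfolding geo_mean_set_def by blast
    show ?thesis
      unfolding MN(1) H_def det[OF MN(2,3)] det[OF P(1) Q(1)]
      using P(2)[OF MN(2)] Q(2)[OF MN(3)] det_pos[OF MN(2)] det_pos[OF MN(3)] assms(7,8)
      by (intro mult_mono powr_mono2) auto
  qed
  \<comment> \<open>Every maximiser satisfies this one inequality, because \<open>H\<close> itself
    lies in the set.\<close>
  have uniq: "K = H" if K: "K \<in> geo_mean_set t n G A F B" "Re (det H) \<le> Re (det K)" for K
  proof -
    obtain M N where MN: "K = geo_mean t M N" "M \<in> pd_completions n G A" "N \<in> pd_completions n F B"
      using K(1) unfolding geo_mean_set_def by blast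
    note MN_pd = pd[OF MN(2)] pd[OF MN(3)] and PQ_pd = pd[OF P(1)] pd[OF Q(1)]
    consider "t = 0" | "t = 1" | "0 < t" "t < 1" using assms(7,8) by linarith
    then show ?thesis
    proof cases
      case 1
      then have "K = M" "H = P" using MN(1) by (simp_all add: H_def geo_mean_0[OF MN_pd] geo_mean_0[OF PQ_pd])
      then show ?thesis using K(2) P(2,3)[OF MN(2)] by simp
    next
      case 2
      then have "K = N" "H = Q" using MN(1) by (simp_all add: H_def geo_mean_1[OF MN_pd] geo_mean_1[OF PQ_pd])
      then show ?thesis using K(2) Q(2,3)[OF MN(3)] by simp
    next
      case 3
      have "Re (det M) = Re (det P)" "Re (det N) = Re (det Q)"
        using weighted_product_max[OF det_pos[OF MN(2)] P(2)[OF MN(2)] det_pos[OF MN(3)] Q(2)[OF MN(3)] 3]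
          K(2) unfolding MN(1) H_def det[OF MN(2,3)] det[OF P(1) Q(1)] by auto
      then have "M = P" "N = Q" using P(3)[OF MN(2)] Q(3)[OF MN(3)] by auto
      then show ?thesis by (simp add: MN(1) H_def)
    qed
  qed
  show ?thesis
    unfolding Let_def P_def[symmetric] Q_def[symmetric] H_def[symmetric]
    using H max uniq by blast
qed

end
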